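(* Let $n \ge k \ge r \ge 2$ be integers, and define \[ c_{k,r} \coloneqq \begin{cases} \frac{k-r+1}{k+2}, & \text{if } k < \frac{4r-2}{3},\\[2pt] \frac{3k-3r+1}{3k-2}, & \text{if } k \ge \frac{4r-2}{3}.\end{cases} \] Suppose that $\mathcal{H}$ is a $k$-partite $r$-graph on $n$ vertices with no isolated vertices and $\delta_{r-1}^{+}(\mathcal{H}) > c_{k,r}\, n$. Then $\mathcal{H}$ is uniquely $k$-colorable. Moreover, both constants $\frac{k-r+1}{k+2}$ and $\frac{3k-3r+1}{3k-2}$ are optimal, i.e., in each of the two ranges of $k$, for every real $c < c_{k,r}$ there exist $n \ge k$ and an $n$-vertex $k$-partite $r$-graph without isolated vertices with $\delta_{r-1}^{+}(\mathcal{H}) > c\, n$ that is not uniquely $k$-colorable.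
   Context: An $r$-graph $\mathcal{H}$ is a collection of $r$-element subsets (edges) of a finite vertex set $V(\mathcal{H})$; a vertex is isolated if it lies in no edge. The shadow $\partial\mathcal{H}$ is the set of $(r-1)$-subsets of $V(\mathcal{H})$ contained in some edge. For an $(r-1)$-set $S$, $d_{\mathcal{H}}(S)$ is the number of vertices $v$ with $S\cup\{v\}\in\mathcal{H}$. The minimum positive codegree is $\delta^{+}_{r-1}(\mathcal{H}) = \min\{d_{\mathcal{H}}(S) : S \in \partial\mathcal{H}\}$. A $k$-coloring of $\mathcal{H}$ is a map $\varphi: V(\mathcal{H})\to[k]$ that is injective on every edge (equivalently a homomorphism to the complete $r$-graph $K_k^r$ on $[k]$); $\mathcal{H}$ is $k$-partite ($k$-colorable) if it has a $k$-coloring. Two $k$-colorings $\varphi,\vartheta$ are equivalent if $\vartheta=\eta\circ\varphi$ for some permutation $\eta$ of $[k]$. $\mathcal{H}$ is uniquely $k$-colorable if it is $k$-colorable and any two of its $k$-colorings are equivalent. *)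

theory Defs
  imports Complex_Main "HOL-Library.FuncSet" "HOL-Combinatorics.Permutations"
begin

definition r_graph :: "nat \<Rightarrow> 'a set \<Rightarrow> 'a set set \<Rightarrow> bool" where
  "r_graph r V E \<longleftrightarrow> finite V \<and> (\<forall>e\<in>E. e \<subseteq> V \<and> card e = r)"

definition no_isolated_vertices :: "'a set \<Rightarrow> 'a set set \<Rightarrow> bool" where
  "no_isolated_vertices V E \<longleftrightarrow> (\<forall>v\<in>V. \<exists>e\<in>E. v \<in> e)"

definition shadow :: "nat \<Rightarrow> 'a set \<Rightarrow> 'a set set \<Rightarrow> 'a set set" where
  "shadow r V E = {S. S \<subseteq> V \<and> card S = r - 1 \<and> (\<exists>e\<in>E. S \<subseteq> e)}"

definition codegree :: "'a set \<Rightarrow> 'a set set \<Rightarrow> 'a set \<Rightarrow> nat" where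
  "codegree V E S = card {v\<in>V. S \<union> {v} \<in> E}"

text \<open>The minimum is unspecified when the shadow is empty, that is, when there are no edges.\<close>

definition min_pos_codegree :: "nat \<Rightarrow> 'a set \<Rightarrow> 'a set set \<Rightarrow> nat" where
  "min_pos_codegree r V E = Min (codegree V E ` shadow r V E)"

definition k_coloring :: "nat \<Rightarrow> 'a set \<Rightarrow> 'a set set \<Rightarrow> ('a \<Rightarrow> nat) \<Rightarrow> bool" where
  "k_coloring k V E \<phi> \<longleftrightarrow> \<phi> \<in> V \<rightarrow> {1..k} \<and> (\<forall>e\<in>E. inj_on \<phi> e)"

definition k_partite :: "nat \<Rightarrow> 'a set \<Rightarrow> 'a set set \<Rightarrow> bool" where
  "k_partite k V E \<longleftrightarrow> (\<exists>\<phi>. k_coloring k V E \<phi>)"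

text \<open>Colorings are total functions of which only the values on the vertex set matter.\<close>

definition equivalent_colorings :: "nat \<Rightarrow> 'a set \<Rightarrow> ('a \<Rightarrow> nat) \<Rightarrow> ('a \<Rightarrow> nat) \<Rightarrow> bool" where
  "equivalent_colorings k V \<phi> \<theta> \<longleftrightarrow> (\<exists>\<eta>. \<eta> permutes {1..k} \<and> (\<forall>v\<in>V. \<theta> v = \<eta> (\<phi> v)))"

definition uniquely_k_colorable :: "nat \<Rightarrow> 'a set \<Rightarrow> 'a set set \<Rightarrow> bool" where
  "uniquely_k_colorable k V E \<longleftrightarrow> k_partite k V E \<and>
     (\<forall>\<phi> \<theta>. k_coloring k V E \<phi> \<longrightarrow> k_coloring k V E \<theta> \<longrightarrow> equivalent_colorings k V \<phi> \<theta>)"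

definition c_const :: "nat \<Rightarrow> nat \<Rightarrow> real" where
  "c_const k r =
     (if real k < (4 * real r - 2) / 3
      then (real k - real r + 1) / (real k + 2)
      else (3 * real k - 3 * real r + 1) / (3 * real k - 2))"

end

theory Submission
  imports Defs
begin

text \<open>
  Given two colourings \<open>\<phi>\<close> and \<open>\<theta>\<close>, place each vertex \<open>v\<close> in the cell \<open>(\<phi> v, \<theta> v)\<close> of a
  \<open>k \<times> k\<close> board; the colourings are equivalent iff no two occupied cells share a row or a column.
  Put \<open>m = k - r\<close>, which does not change when passing to the link of a vertex. An exchange argument
  shows that any \<open>m + 1\<close> colour classes together have at least \<open>\<delta>\<close> vertices, where \<open>\<delta>\<close> is the
  minimum positive codegree. We argue by induction on \<open>r\<close>, calling \<open>u\<close> and \<open>v\<close> adjacent if some edge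
  contains both.

  If \<open>r \<le> 3 m + 2\<close>, scale weights so that the total is \<open>3 k - 2\<close> and \<open>\<delta> > 3 m + 1\<close>. A vertex whose
  non-neighbours weigh at least \<open>3\<close> is heavy: its link satisfies the induction hypothesis, so its
  neighbours occupy a perfect matching of the remaining cells, each of weight more than \<open>1\<close>. Take a maximal
  set \<open>\<mu>\<close> of light vertices in distinct rows and columns. As the non-neighbours of \<open>x \<in> \<mu>\<close> contain the row
  and the column of \<open>x\<close> and weigh less than \<open>3\<close>, counting shows that all vertices lie in the cells of \<open>\<mu>\<close> or
  in the block avoiding the rows and columns of \<open>\<mu>\<close>. The block consists of heavy vertices, and adjacent
  heavy vertices see the same matching; two different matchings in the block would weigh too much.

  If \<open>r > 3 m + 2\<close>, scale to total \<open>k + 2\<close> and \<open>\<delta> > m + 1\<close>, and call \<open>v\<close> heavy if its non-neighbours weigh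
  at least \<open>1\<close>. Light vertices lie in at most \<open>m\<close> rows, so every set in the shadow contains a heavy
  vertex. Hence the edges split according to the matching seen by their heavy vertices, each part
  has minimum positive codegree at least \<open>\<delta>\<close>, and two parts already weigh more than \<open>k + r\<close>.
\<close>

section \<open>Links and colour classes\<close>


text \<open>The number \<open>d\<close> is a lower bound for the codegrees rather than their
  minimum, so the same \<open>d\<close> passes to links and to suitable subgraphs, and an empty edge
  set causes no trouble.\<close>

definition codegree_graph :: "nat \<Rightarrow> nat \<Rightarrow> 'a set \<Rightarrow> 'a set set \<Rightarrow> bool" where
  "codegree_graph r d V E \<longleftrightarrow> finite V \<and> (\<forall>e\<in>E. e \<subseteq> V \<and> card e = r) \<and> (\<forall>v\<in>V. \<exists>e\<in>E. v \<in> e) \<and>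
     (\<forall>S. card S = r - 1 \<longrightarrow> (\<exists>e\<in>E. S \<subseteq> e) \<longrightarrow> d \<le> card {v\<in>V. insert v S \<in> E})"

text \<open>The palette is an arbitrary set because passing to the link of \<open>v\<close> removes
  the colour of \<open>v\<close> from it.\<close>

definition proper_coloring :: "'c set \<Rightarrow> 'a set \<Rightarrow> 'a set set \<Rightarrow> ('a \<Rightarrow> 'c) \<Rightarrow> bool" where
  "proper_coloring C V E \<phi> \<longleftrightarrow> \<phi> ` V \<subseteq> C \<and> (\<forall>e\<in>E. inj_on \<phi> e)"

definition nbhd :: "'a set set \<Rightarrow> 'a \<Rightarrow> 'a set" where
  "nbhd E v = {u. u \<noteq> v \<and> (\<exists>e\<in>E. u \<in> e \<and> v \<in> e)}"

definition link :: "'a set set \<Rightarrow> 'a \<Rightarrow> 'a set set" where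
  "link E v = {f. v \<notin> f \<and> insert v f \<in> E}"

text \<open>Both colourings induce the same partition of \<open>A\<close>. In contrast to
  equivalence up to a permutation, this mentions no palette and restricts to subsets.\<close>

definition matched :: "('a \<Rightarrow> 'c) \<Rightarrow> ('a \<Rightarrow> 'c) \<Rightarrow> 'a set \<Rightarrow> bool" where
  "matched \<phi> \<theta> A \<longleftrightarrow> (\<forall>u\<in>A. \<forall>v\<in>A. \<phi> u = \<phi> v \<longleftrightarrow> \<theta> u = \<theta> v)"

lemma nbhd_sym: "u \<in> nbhd E v \<longleftrightarrow> v \<in> nbhd E u"
  by (auto simp: nbhd_def)

lemma nbhd_subset: "codegree_graph r d V E \<Longrightarrow> nbhd E v \<subseteq> V"
  by (auto simp: nbhd_def codegree_graph_def)

lemma nbhd_color_neq: "proper_coloring C V E \<phi> \<Longrightarrow> u \<in> nbhd E v \<Longrightarrow> \<phi> u \<noteq> \<phi> v"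
  by (auto simp: nbhd_def proper_coloring_def inj_on_def)

lemma nbhd_link_subset: "nbhd (link E v) w \<subseteq> nbhd E v \<inter> nbhd E w"
  by (auto simp: nbhd_def link_def)

text \<open>Adjoining \<open>v\<close> turns a shadow set of the link into a shadow set of
  \<open>E\<close> with the same extensions, so \<open>d\<close> is kept while the uniformity falls
  by one.\<close>

lemma codegree_graph_link:
  assumes "codegree_graph (Suc r) d V E" "1 \<le> r"
  shows "codegree_graph r d (nbhd E v) (link E v)"
  unfolding codegree_graph_def
proof (intro conjI allI impI ballI)
  have finV: "finite V" and edge: "\<And>e. e \<in> E \<Longrightarrow> e \<subseteq> V \<and> card e = Suc r"
    and deg: "\<And>S. card S = r \<Longrightarrow> (\<exists>e\<in>E. S \<subseteq> e) \<Longrightarrow> d \<le> card {v\<in>V. insert v S \<in> E}"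
    using assms(1) by (auto simp: codegree_graph_def)
  show fin: "finite (nbhd E v)"
    using finV nbhd_subset[OF assms(1)] finite_subset by blast
  show "f \<subseteq> nbhd E v" if "f \<in> link E v" for f
    using that by (auto simp: link_def nbhd_def)
  show "card f = r" if "f \<in> link E v" for f
  proof -
    have "insert v f \<in> E" "v \<notin> f" using that by (auto simp: link_def)
    moreover from this have "finite f" using edge finV by (meson finite_subset insert_subset)
    ultimately show ?thesis using edge[of "insert v f"] by simp
  qed
  show "\<exists>f\<in>link E v. u \<in> f" if u: "u \<in> nbhd E v" for u
  proof -
    obtain e where "u \<noteq> v" "e \<in> E" "u \<in> e" "v \<in> e" using u by (auto simp: nbhd_def)
    then show ?thesis by (intro bexI[of _ "e - {v}"]) (auto simp: link_def insert_absorb)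
  qed
  fix S assume S: "card S = r - 1" "\<exists>f\<in>link E v. S \<subseteq> f"
  then obtain f where f: "v \<notin> f" "insert v f \<in> E" "S \<subseteq> f" by (auto simp: link_def)
  have finS: "finite S" using f edge finV by (meson finite_subset insert_subset)
  have vS: "v \<notin> S" using f by auto
  have card: "card (insert v S) = r" using S(1) finS vS assms(2) by simp
  have "d \<le> card {u\<in>V. insert u (insert v S) \<in> E}"
    using deg[OF card] f by blast
  also have "\<dots> \<le> card {u \<in> nbhd E v. insert u S \<in> link E v}"
  proof (rule card_mono)
    show "finite {u \<in> nbhd E v. insert u S \<in> link E v}" using fin by simp
    show "{u \<in> V. insert u (insert v S) \<in> E} \<subseteq> {u \<in> nbhd E v. insert u S \<in> link E v}"
    proof
      fix u assume u: "u \<in> {u \<in> V. insert u (insert v S) \<in> E}"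
      have "u \<noteq> v"
      proof
        assume "u = v"
        then have "insert v S \<in> E" using u by simp
        then show False using edge[of "insert v S"] card by simp
      qed
      then show "u \<in> {u \<in> nbhd E v. insert u S \<in> link E v}"
        using u vS by (auto simp: nbhd_def link_def insert_commute)
    qed
  qed
  finally show "d \<le> card {u \<in> nbhd E v. insert u S \<in> link E v}" .
qed

lemma proper_coloring_link:
  assumes "codegree_graph r d V E" "proper_coloring C V E \<phi>"
  shows "proper_coloring (C - {\<phi> v}) (nbhd E v) (link E v) \<phi>"
  unfolding proper_coloring_def
proof (intro conjI ballI)
  show "\<phi> ` nbhd E v \<subseteq> C - {\<phi> v}"
    using nbhd_subset[OF assms(1), of v] nbhd_color_neq[OF assms(2), of _ v] assms(2)
    by (auto simp: proper_coloring_def)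
  show "inj_on \<phi> f" if "f \<in> link E v" for f
    using that assms(2) by (auto simp: proper_coloring_def link_def intro: inj_on_subset)
qed

text \<open>Choose \<open>S\<close> in the shadow with as many vertices as possible coloured outside \<open>I\<close>; then all
  extensions of \<open>S\<close> are coloured in \<open>I\<close>, since otherwise an exchange would improve \<open>S\<close>.\<close>

lemma codegree_le_classes:
  assumes G: "codegree_graph r d V E" and col: "proper_coloring C V E \<phi>" and C: "finite C"
    and r: "1 \<le> r" and E: "E \<noteq> {}" and I: "I \<subseteq> C" "card I + r = card C + 1"
  shows "d \<le> card {v\<in>V. \<phi> v \<in> I}"
proof -
  have finV: "finite V" and edge: "\<And>e. e \<in> E \<Longrightarrow> e \<subseteq> V \<and> card e = r"
    and deg: "\<And>S. card S = r - 1 \<Longrightarrow> (\<exists>e\<in>E. S \<subseteq> e) \<Longrightarrow> d \<le> card {v\<in>V. insert v S \<in> E}"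
    using G by (auto simp: codegree_graph_def)
  define Sh where "Sh = {S. card S = r - 1 \<and> (\<exists>e\<in>E. S \<subseteq> e)}"
  have Sh_sub: "Sh \<subseteq> Pow V" using edge by (auto simp: Sh_def)
  then have finSh: "finite Sh" using finV by (simp add: finite_subset)
  obtain e where e: "e \<in> E" using E by auto
  then have "finite e" "card e = r" using edge finV finite_subset by blast+
  then obtain T where "T \<subseteq> e" "card T = r - 1"
    using obtain_subset_with_card_n[of "r - 1" e] by (metis diff_le_self)
  then have "Sh \<noteq> {}" using e by (auto simp: Sh_def)
  define out where "out S = card {s\<in>S. \<phi> s \<notin> I}" for S
  have "Max (out ` Sh) \<in> out ` Sh" using finSh \<open>Sh \<noteq> {}\<close> by simp
  then obtain S where S: "S \<in> Sh" "out S = Max (out ` Sh)" by auto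
  have max: "out S' \<le> out S" if "S' \<in> Sh" for S'
    using that S(2) finSh by simp
  have cardS: "card S = r - 1" and exS: "\<exists>e\<in>E. S \<subseteq> e" using S by (auto simp: Sh_def)
  have finS: "finite S" and SV: "S \<subseteq> V" using S(1) Sh_sub finV by (auto intro: finite_subset)
  have "{v\<in>V. insert v S \<in> E} \<subseteq> {v\<in>V. \<phi> v \<in> I}"
  proof safe
    fix x assume x: "x \<in> V" "insert x S \<in> E"
    show "\<phi> x \<in> I"
    proof (rule ccontr)
      assume nI: "\<phi> x \<notin> I"
      have "x \<notin> S" using edge[OF x(2)] cardS r finS by (auto simp: insert_absorb)
      have inj: "inj_on \<phi> (insert x S)" using x(2) col by (auto simp: proper_coloring_def)
      show False
      proof (cases "\<exists>s\<in>S. \<phi> s \<in> I")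
        case True
        then obtain s where s: "s \<in> S" "\<phi> s \<in> I" by auto
        define S' where "S' = insert x (S - {s})"
        have "card S' = Suc (card (S - {s}))" using \<open>x \<notin> S\<close> finS by (simp add: S'_def)
        then have "card S' = r - 1" using card_Suc_Diff1[OF finS s(1)] cardS by simp
        moreover have "S' \<subseteq> insert x S" by (auto simp: S'_def)
        ultimately have "S' \<in> Sh" using x(2) by (auto simp: Sh_def)
        have "{t\<in>S'. \<phi> t \<notin> I} = insert x {t\<in>S. \<phi> t \<notin> I}"
          using s nI by (auto simp: S'_def)
        then have "out S' = Suc (out S)" using finS \<open>x \<notin> S\<close> by (simp add: out_def)
        then show False using max[OF \<open>S' \<in> Sh\<close>] by simp
      next
        case False
        \<comment> \<open>Otherwise the \<open>r\<close> vertices of an edge would have distinct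
          colours in \<open>C - I\<close>, which has only \<open>r - 1\<close> elements.\<close>
        then have "\<phi> ` insert x S \<subseteq> C - I"
          using nI x(1) SV col by (auto simp: proper_coloring_def)
        then have "card (\<phi> ` insert x S) \<le> card (C - I)" using C by (intro card_mono) auto
        moreover have "card (\<phi> ` insert x S) = r"
          using card_image[OF inj] edge[OF x(2)] by simp
        moreover have "card (C - I) = card C - card I"
          using I C by (intro card_Diff_subset) (auto intro: finite_subset)
        moreover have "card I \<le> card C" using I C by (simp add: card_mono)
        ultimately show False using I(2) by linarith
      qed
    qed
  qed
  then have "card {v\<in>V. insert v S \<in> E} \<le> card {v\<in>V. \<phi> v \<in> I}"
    using finV by (intro card_mono) auto
  then show ?thesis using deg[OF cardS exS] by linarith
qed

lemma link_nonempty: "codegree_graph r d V E \<Longrightarrow> v \<in> V \<Longrightarrow> link E v \<noteq> {}"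
proof -
  assume "codegree_graph r d V E" "v \<in> V"
  then obtain e where "e \<in> E" "v \<in> e" by (auto simp: codegree_graph_def)
  then have "e - {v} \<in> link E v" by (auto simp: link_def insert_absorb)
  then show ?thesis by auto
qed

text \<open>The class bound in the link of \<open>v\<close>: palette and uniformity both drop by
  one, so the required size of \<open>I\<close> is unchanged.\<close>

lemma codegree_le_nbhd_classes:
  assumes G: "codegree_graph r d V E" and col: "proper_coloring C V E \<phi>" and C: "finite C"
    and r: "2 \<le> r" and v: "v \<in> V" and I: "I \<subseteq> C - {\<phi> v}" "card I + r = card C + 1"
  shows "d \<le> card {u \<in> nbhd E v. \<phi> u \<in> I}"
proof -
  obtain r' where r': "r = Suc r'" "1 \<le> r'" using r by (cases r) auto
  have "\<phi> v \<in> C" using v col by (auto simp: proper_coloring_def)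
  then have "card (C - {\<phi> v}) + 1 = card C" using C card_Suc_Diff1[of C "\<phi> v"] by simp
  then show ?thesis
    using codegree_le_classes[OF codegree_graph_link[OF G[unfolded r'(1)] r'(2)]
        proper_coloring_link[OF G col, of v] _ r'(2) link_nonempty[OF G v] I(1)] C I(2) r'(1)
    by simp
qed

text \<open>The same bound one link deeper: a neighbour of \<open>w\<close> inside the link of
  \<open>v\<close> is a common neighbour of \<open>v\<close> and \<open>w\<close>.\<close>

lemma codegree_le_common_nbhd_classes:
  assumes G: "codegree_graph r d V E" and col: "proper_coloring C V E \<phi>" and C: "finite C"
    and r: "3 \<le> r" and v: "v \<in> V" and w: "w \<in> nbhd E v"
    and I: "I \<subseteq> C - {\<phi> v, \<phi> w}" "card I + r = card C + 1"
  shows "d \<le> card {u \<in> nbhd E v \<inter> nbhd E w. \<phi> u \<in> I}"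
proof -
  obtain r' where r': "r = Suc r'" "2 \<le> r'" using r by (cases r) auto
  have G': "codegree_graph r' d (nbhd E v) (link E v)"
    using codegree_graph_link[of r' d V E v] G r' by simp
  have vC: "\<phi> v \<in> C" using v col by (auto simp: proper_coloring_def)
  have "d \<le> card {u \<in> nbhd (link E v) w. \<phi> u \<in> I}"
  proof (rule codegree_le_nbhd_classes[OF G' proper_coloring_link[OF G col, of v] _ r'(2) w])
    show "I \<subseteq> C - {\<phi> v} - {\<phi> w}" using I(1) by auto
    have "0 < card C" using vC C by (auto simp: card_gt_0_iff)
    then show "card I + r' = card (C - {\<phi> v}) + 1" using vC C I(2) r'(1) by simp
  qed (use C in simp)
  also have "\<dots> \<le> card {u \<in> nbhd E v \<inter> nbhd E w. \<phi> u \<in> I}"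
  proof (rule card_mono)
    show "finite {u \<in> nbhd E v \<inter> nbhd E w. \<phi> u \<in> I}"
      using G' by (auto simp: codegree_graph_def)
  qed (use nbhd_link_subset[of E v w] in auto)
  finally show ?thesis .
qed

text \<open>Removing an element of maximal weight does not raise the average, so elements are
  removed from \<open>Q\<close> one at a time until \<open>j\<close> are left.\<close>

lemma exists_light_subset:
  fixes f :: "'c \<Rightarrow> real"
  assumes "finite Q" "j \<le> card Q"
  shows "\<exists>J\<subseteq>Q. card J = j \<and> real (card Q) * sum f J \<le> real j * sum f Q"
  using assms(2)
proof (induction "card Q - j" arbitrary: j)
  case 0
  then show ?case by (intro exI[of _ Q]) auto
next
  case (Suc n)
  then have "n = card Q - Suc j" "Suc j \<le> card Q" by auto
  from Suc(1)[OF this] obtain J where J: "J \<subseteq> Q" "card J = Suc j"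
    "real (card Q) * sum f J \<le> real (Suc j) * sum f Q" by auto
  have finJ: "finite J" using J(1) assms(1) finite_subset by auto
  have "Max (f ` J) \<in> f ` J" using finJ J(2) by (intro Max_in) auto
  then obtain a where a: "a \<in> J" "f a = Max (f ` J)" by auto
  have "sum f J \<le> (\<Sum>x\<in>J. f a)" using a(2) finJ by (intro sum_mono) simp
  then have le: "sum f J \<le> real (Suc j) * f a" using J(2) by simp
  have split: "sum f J = f a + sum f (J - {a})" using finJ a(1) by (simp add: sum.remove)
  have "real (Suc j) * (real (card Q) * sum f (J - {a})) \<le> real (Suc j) * (real j * sum f Q)"
  proof -
    have "real (Suc j) * sum f (J - {a}) \<le> real j * sum f J"
      using le split by (simp add: algebra_simps)
    then have "real (card Q) * (real (Suc j) * sum f (J - {a})) \<le> real (card Q) * (real j * sum f J)"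
      by (intro mult_left_mono) auto
    also have "\<dots> = real j * (real (card Q) * sum f J)" by simp
    also have "\<dots> \<le> real j * (real (Suc j) * sum f Q)" using J(3) by (intro mult_left_mono) auto
    finally show ?thesis by (simp only: mult.left_commute mult.assoc mult.commute)
  qed
  then have "real (card Q) * sum f (J - {a}) \<le> real j * sum f Q"
    by (rule mult_left_le_imp_le) simp
  then show ?case using J a finJ by (intro exI[of _ "J - {a}"]) auto
qed

text \<open>Complete \<open>T\<close> by \<open>j\<close> elements of \<open>Q - T\<close> whose
  average weight is at most that of \<open>Q - T\<close>, apply the lower bound to the result and
  clear denominators.\<close>

lemma subset_sum_average:
  fixes f :: "'c \<Rightarrow> real"
  assumes Q: "finite Q" and T: "T \<subseteq> Q" and j: "card T + j \<le> card Q"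
    and large: "\<And>I. I \<subseteq> Q \<Longrightarrow> card I = card T + j \<Longrightarrow> a < sum f I" and lt: "card T < card Q"
  shows "a * real (card Q - card T) < sum f T * real (card Q - card T) + real j * sum f (Q - T)"
proof -
  have finT: "finite T" using T Q finite_subset by auto
  have c: "card (Q - T) = card Q - card T" using T finT by (simp add: card_Diff_subset)
  obtain J where J: "J \<subseteq> Q - T" "card J = j"
    "real (card (Q - T)) * sum f J \<le> real j * sum f (Q - T)"
    using exists_light_subset[of "Q - T" j f] Q j c by (metis add_le_imp_le_diff add.commute finite_Diff)
  have finJ: "finite J" using J(1) Q finite_subset by blast
  have disj: "T \<inter> J = {}" using J(1) by auto
  have "a < sum f (T \<union> J)"
    using J T finT finJ disj by (intro large) (auto simp: card_Un_disjoint)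
  then have "a < sum f T + sum f J" using finT finJ disj by (simp add: sum.union_disjoint)
  then have "a * real (card Q - card T) < (sum f T + sum f J) * real (card Q - card T)"
    using lt by (intro mult_strict_right_mono) auto
  then show ?thesis using J(3)[unfolded c] unfolding distrib_right by (smt (verit) mult.commute)
qed

lemma card_classes_sum:
  assumes "finite A" "finite I"
  shows "c * real (card {x\<in>A. \<phi> x \<in> I}) = (\<Sum>i\<in>I. c * real (card {x\<in>A. \<phi> x = i}))"
proof -
  have "{x\<in>A. \<phi> x \<in> I} = (\<Union>i\<in>I. {x\<in>A. \<phi> x = i})" by auto
  then have "card {x\<in>A. \<phi> x \<in> I} = (\<Sum>i\<in>I. card {x\<in>A. \<phi> x = i})"
    using assms by (simp only:) (rule card_UN_disjoint, auto)
  then show ?thesis by (simp add: sum_distrib_left)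
qed


section \<open>Light and heavy vertices\<close>

text \<open>The members of \<open>N\<close> are the light vertices, \<open>U v\<close> is the neighbourhood of \<open>v\<close>, and \<open>c\<close> is the weight
  of a single vertex.\<close>

locale cell_system =
  fixes V N :: "'a set" and R C :: "'c set" and \<phi> \<theta> :: "'a \<Rightarrow> 'c" and U :: "'a \<Rightarrow> 'a set"
    and c :: real and k :: nat
  assumes finV: "finite V" and finR: "finite R" and finC: "finite C"
    and cardR: "card R = k" and cardC: "card C = k"
    and rowR: "v \<in> V \<Longrightarrow> \<phi> v \<in> R" and colC: "v \<in> V \<Longrightarrow> \<theta> v \<in> C"
    and U_sub: "U v \<subseteq> V" and U_sym: "u \<in> U v \<longleftrightarrow> v \<in> U u"
    and U_row: "u \<in> U v \<Longrightarrow> \<phi> u \<noteq> \<phi> v" and U_col: "u \<in> U v \<Longrightarrow> \<theta> u \<noteq> \<theta> v"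
    and c_pos: "0 < c" and total: "c * real (card V) = 3 * real k - 2"
    and N_sub: "N \<subseteq> V" and light: "v \<in> N \<Longrightarrow> c * real (card (V - U v)) < 3"
    and heavy_matched: "v \<in> V - N \<Longrightarrow> matched \<phi> \<theta> (U v)"
    and heavy_row: "v \<in> V - N \<Longrightarrow> i \<in> R \<Longrightarrow> i \<noteq> \<phi> v \<Longrightarrow> \<exists>x\<in>U v. \<phi> x = i"
    and heavy_col: "v \<in> V - N \<Longrightarrow> j \<in> C \<Longrightarrow> j \<noteq> \<theta> v \<Longrightarrow> \<exists>x\<in>U v. \<theta> x = j"
    and heavy_cell: "v \<in> V - N \<Longrightarrow> x \<in> U v \<Longrightarrow> 1 < c * real (card {y\<in>V. \<phi> y = \<phi> x \<and> \<theta> y = \<theta> x})"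
begin

definition w :: "'a set \<Rightarrow> real" where "w A = c * real (card A)"

definition cell :: "'a \<Rightarrow> 'a set" where "cell x = {y\<in>V. \<phi> y = \<phi> x \<and> \<theta> y = \<theta> x}"

text \<open>The assumptions are symmetric in rows and columns; this yields the column versions of
  the one-sided lemmas below.\<close>

lemma swap: "cell_system V N C R \<theta> \<phi> U c k"
proof (unfold_locales)
  show "matched \<theta> \<phi> (U v)" if "v \<in> V - N" for v
    using heavy_matched[OF that] by (auto simp: matched_def)
  show "1 < c * real (card {y\<in>V. \<theta> y = \<theta> x \<and> \<phi> y = \<phi> x})" if "v \<in> V - N" "x \<in> U v" for v x
    using heavy_cell[OF that] by (simp add: conj_commute)
qed (fact finV finR finC cardR cardC rowR colC U_sub U_sym U_row U_col c_pos total N_sub light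
    heavy_row heavy_col)+

lemma swap_cell: "cell_system.cell V \<theta> \<phi> = cell"
  using cell_system.cell_def[OF swap] by (auto simp: fun_eq_iff cell_def)

lemma w_nonneg [simp]: "0 \<le> w A"
  using c_pos by (simp add: w_def)

lemma w_mono: "A \<subseteq> B \<Longrightarrow> B \<subseteq> V \<Longrightarrow> w A \<le> w B"
  using c_pos finV by (auto simp: w_def intro!: mult_left_mono card_mono finite_subset[of B V])

lemma w_Un: "A \<subseteq> V \<Longrightarrow> B \<subseteq> V \<Longrightarrow> A \<inter> B = {} \<Longrightarrow> w (A \<union> B) = w A + w B"
  using finV by (simp add: w_def card_Un_disjoint finite_subset distrib_left)

lemma w_Un_le: "w (A \<union> B) \<le> w A + w B"
  using card_Un_le[of A B] c_pos
  by (simp add: w_def flip: distrib_left of_nat_add)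

lemma w_pos: "0 < w A \<Longrightarrow> A \<noteq> {}"
  by (auto simp: w_def)

lemma cell_sub: "cell x \<subseteq> V"
  by (auto simp: cell_def)

lemma heavy_cell_w: "v \<in> V - N \<Longrightarrow> x \<in> U v \<Longrightarrow> 1 < w (cell x)"
  using heavy_cell by (simp add: w_def cell_def)

lemma heavy_eq: "v \<in> V - N \<Longrightarrow> x \<in> U v \<Longrightarrow> y \<in> U v \<Longrightarrow> \<phi> x = \<phi> y \<longleftrightarrow> \<theta> x = \<theta> y"
  using heavy_matched by (auto simp: matched_def)

lemma cross: "y \<in> V \<Longrightarrow> \<phi> y = \<phi> x \<or> \<theta> y = \<theta> x \<Longrightarrow> y \<in> V - U x"
  using U_row[of y x] U_col[of y x] by auto

lemma cover_le:
  assumes "finite F" "F \<subseteq> V"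
  shows "w V \<le> (\<Sum>x\<in>F. w (V - U x)) + w {v\<in>V. \<forall>x\<in>F. v \<in> U x}"
  using assms
proof (induction F rule: finite_induct)
  case empty
  then show ?case by simp
next
  case (insert a F)
  let ?A = "{v\<in>V. \<forall>x\<in>F. v \<in> U x}" and ?B = "{v\<in>V. \<forall>x\<in>insert a F. v \<in> U x}"
  have "w ?A \<le> w ((V - U a) \<union> ?B)" by (intro w_mono) auto
  also have "\<dots> \<le> w (V - U a) + w ?B" by (rule w_Un_le)
  finally show ?case using insert by simp
qed

text \<open>Union bound: each light vertex excludes weight less than \<open>3\<close>. With
  \<open>k - 1\<close> light vertices, the common neighbours still weigh more than
  \<open>1\<close>.\<close>

lemma cover:
  assumes "F \<subseteq> N" "F \<noteq> {}"
  shows "3 * real k - 2 - 3 * real (card F) < w {v\<in>V. \<forall>x\<in>F. v \<in> U x}"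
proof -
  have fin: "finite F" using assms N_sub finV by (meson finite_subset subset_trans)
  have "(\<Sum>x\<in>F. w (V - U x)) < (\<Sum>x\<in>F. 3)"
    using assms fin light by (intro sum_strict_mono) (auto simp: w_def)
  moreover have "w V \<le> (\<Sum>x\<in>F. w (V - U x)) + w {v\<in>V. \<forall>x\<in>F. v \<in> U x}"
    using assms N_sub fin by (intro cover_le) auto
  ultimately show ?thesis using total by (simp add: w_def)
qed

text \<open>The cell of \<open>x\<close>, the rest of its row and the rest of its column are
  disjoint and consist of non-neighbours of \<open>x\<close>, so they share a budget of
  \<open>3\<close>.\<close>

lemma three_parts:
  assumes x: "x \<in> N" and A: "A \<subseteq> cell x" and B: "B \<subseteq> V" "\<And>y. y \<in> B \<Longrightarrow> \<phi> y = \<phi> x \<and> \<theta> y \<noteq> \<theta> x"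
    and D: "D \<subseteq> V" "\<And>y. y \<in> D \<Longrightarrow> \<theta> y = \<theta> x \<and> \<phi> y \<noteq> \<phi> x"
  shows "w A + w B + w D < 3"
proof -
  have AV: "A \<subseteq> V" using A cell_sub by blast
  have A': "\<phi> y = \<phi> x \<and> \<theta> y = \<theta> x" if "y \<in> A" for y
    using A that by (auto simp: cell_def)
  have "A \<inter> B = {}" using A' B(2) by blast
  moreover have "(A \<union> B) \<inter> D = {}" using A' B(2) D(2) by blast
  ultimately have "w (A \<union> B \<union> D) = w A + w B + w D"
    using AV B(1) D(1) by (simp add: w_Un)
  moreover have "A \<union> B \<union> D \<subseteq> V - U x"
    using AV A' B D cross[of _ x] by blast
  then have "w (A \<union> B \<union> D) \<le> w (V - U x)" by (intro w_mono) auto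
  ultimately show ?thesis using light[OF x] by (simp add: w_def)
qed

lemma pinch:
  assumes "x \<in> N" "1 < w (cell x)" "y \<in> V" "\<phi> y = \<phi> x" "\<theta> y \<noteq> \<theta> x" "1 < w (cell y)"
    "z \<in> V" "\<theta> z = \<theta> x" "\<phi> z \<noteq> \<phi> x" "1 < w (cell z)"
  shows False
proof -
  have "w (cell x) + w (cell y) + w (cell z) < 3"
    using assms cell_sub by (intro three_parts[OF assms(1)]) (auto simp: cell_def)
  then show False using assms by linarith
qed

text \<open>The matching seen by \<open>u\<close> meets the row of \<open>x\<close> in
  \<open>z\<close>, hence meets the column of \<open>x\<close> in a different row. Together with the
  cell of \<open>x\<close> this puts three cells of weight above \<open>1\<close> into the cross of
  a light vertex.\<close>

lemma heavy_pinch: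
  assumes u: "u \<in> V - N" and z: "z \<in> U u" "\<phi> z = \<phi> x" "\<theta> z \<noteq> \<theta> x"
    and x: "x \<in> N" "1 < w (cell x)" and ux: "\<theta> u \<noteq> \<theta> x"
  shows False
proof -
  have "\<theta> x \<in> C" using x N_sub colC by auto
  then obtain y where y: "y \<in> U u" "\<theta> y = \<theta> x" using heavy_col[OF u _ ux[symmetric]] by blast
  have "\<phi> y \<noteq> \<phi> x" using heavy_eq[OF u z(1) y(1)] z(2,3) y(2) by simp
  moreover have "y \<in> V" "z \<in> V" using y(1) z(1) U_sub by blast+
  ultimately show False
    using pinch[OF x _ z(2,3) heavy_cell_w[OF u z(1)] _ y(2) _ heavy_cell_w[OF u y(1)]] by blast
qed

section \<open>Maximal partial matchings of light vertices\<close>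

definition maximal_matching :: "'a set \<Rightarrow> bool" where
  "maximal_matching \<mu> \<longleftrightarrow> \<mu> \<subseteq> N \<and> inj_on \<phi> \<mu> \<and> inj_on \<theta> \<mu> \<and> (\<forall>z\<in>N. \<phi> z \<in> \<phi> ` \<mu> \<or> \<theta> z \<in> \<theta> ` \<mu>)"

lemma maximal_matching_exists: "\<exists>\<mu>. maximal_matching \<mu>"
proof -
  let ?M = "{\<mu>. \<mu> \<subseteq> N \<and> inj_on \<phi> \<mu> \<and> inj_on \<theta> \<mu>}"
  have "finite N" using N_sub finV finite_subset by auto
  then have "finite ?M" by (rule finite_subset[rotated, OF finite_Pow_iff[THEN iffD2]]) auto
  moreover have "{} \<in> ?M" by simp
  ultimately obtain \<mu> where \<mu>: "\<mu> \<in> ?M" "\<forall>\<nu>\<in>?M. \<mu> \<le> \<nu> \<longrightarrow> \<mu> = \<nu>"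
    using finite_has_maximal[of ?M] by blast
  have "\<phi> z \<in> \<phi> ` \<mu> \<or> \<theta> z \<in> \<theta> ` \<mu>" if z: "z \<in> N" for z
  proof (rule ccontr)
    assume n: "\<not> ?thesis"
    then have "insert z \<mu> \<in> ?M" using \<mu>(1) z by (auto simp: inj_on_insert)
    then have "\<mu> = insert z \<mu>" using \<mu>(2) by blast
    then show False using n by blast
  qed
  then show ?thesis using \<mu>(1) by (auto simp: maximal_matching_def)
qed

lemma maximal_matching_swap:
  "maximal_matching \<mu> \<Longrightarrow> cell_system.maximal_matching N \<theta> \<phi> \<mu>"
  using cell_system.maximal_matching_def[OF swap] by (auto simp: maximal_matching_def)


lemma w_UN:
  assumes "finite I" "\<And>i. i \<in> I \<Longrightarrow> A i \<subseteq> V" "\<And>i j. i \<in> I \<Longrightarrow> j \<in> I \<Longrightarrow> i \<noteq> j \<Longrightarrow> A i \<inter> A j = {}"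
  shows "w (\<Union>i\<in>I. A i) = (\<Sum>i\<in>I. w (A i))"
proof -
  have "card (\<Union>i\<in>I. A i) = (\<Sum>i\<in>I. card (A i))"
    using assms finV by (intro card_UN_disjoint) (auto intro: finite_subset)
  then show ?thesis by (simp add: w_def sum_distrib_left)
qed

context
  fixes \<mu> assumes \<mu>: "maximal_matching \<mu>"
begin

lemma \<mu>_N: "\<mu> \<subseteq> N" and \<mu>_V: "\<mu> \<subseteq> V" and \<mu>_row: "inj_on \<phi> \<mu>" and \<mu>_col: "inj_on \<theta> \<mu>"
  and \<mu>_max: "z \<in> N \<Longrightarrow> \<phi> z \<in> \<phi> ` \<mu> \<or> \<theta> z \<in> \<theta> ` \<mu>"
  using \<mu> N_sub by (auto simp: maximal_matching_def)

lemma finite_\<mu>: "finite \<mu>"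
  using \<mu>_V finV finite_subset by auto

lemma \<mu>_eq_row: "x \<in> \<mu> \<Longrightarrow> y \<in> \<mu> \<Longrightarrow> \<phi> x = \<phi> y \<Longrightarrow> x = y"
  and \<mu>_eq_col: "x \<in> \<mu> \<Longrightarrow> y \<in> \<mu> \<Longrightarrow> \<theta> x = \<theta> y \<Longrightarrow> x = y"
  using \<mu>_row \<mu>_col by (auto dest: inj_onD)

lemma matched_cells:
  assumes "\<And>v. v \<in> A \<Longrightarrow> \<exists>x\<in>\<mu>. v \<in> cell x"
  shows "matched \<phi> \<theta> A"
  unfolding matched_def
proof (intro ballI)
  fix u v assume "u \<in> A" "v \<in> A"
  then obtain x y where x: "x \<in> \<mu>" "u \<in> cell x" and y: "y \<in> \<mu>" "v \<in> cell y" using assms by metis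
  then show "\<phi> u = \<phi> v \<longleftrightarrow> \<theta> u = \<theta> v"
    using \<mu>_eq_row[OF x(1) y(1)] \<mu>_eq_col[OF x(1) y(1)] by (auto simp: cell_def)
qed

section \<open>Perfect case: light vertices in every row and column\<close>

context
  assumes perfect: "card \<mu> = k"
begin

lemma perfect_row: "v \<in> V \<Longrightarrow> \<exists>x\<in>\<mu>. \<phi> x = \<phi> v"
proof -
  assume v: "v \<in> V"
  have "\<phi> ` \<mu> = R"
    using \<mu>_V rowR finR cardR perfect card_image[OF \<mu>_row] by (intro card_subset_eq) auto
  then show ?thesis using rowR[OF v] by (metis imageE)
qed

lemma perfect_col: "v \<in> V \<Longrightarrow> \<exists>x\<in>\<mu>. \<theta> x = \<theta> v"
proof -
  assume v: "v \<in> V"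
  have "\<theta> ` \<mu> = C"
    using \<mu>_V colC finC cardC perfect card_image[OF \<mu>_col] by (intro card_subset_eq) auto
  then show ?thesis using colC[OF v] by (metis imageE)
qed

definition off :: "'a set" where "off = {v\<in>V. \<forall>x\<in>\<mu>. v \<notin> cell x}"

text \<open>The sets of non-neighbours of the vertices of \<open>\<mu>\<close> cover \<open>V\<close>, and \<open>off\<close> even twice.\<close>

lemma w_off: "w off < 2"
proof -
  define row where "row x = {v\<in>V. \<phi> v = \<phi> x}" for x
  define oc where "oc x = {v\<in>V. \<theta> v = \<theta> x \<and> \<phi> v \<noteq> \<phi> x}" for x
  have "w V = w (\<Union>x\<in>\<mu>. row x)"
    using perfect_row by (intro arg_cong[of _ _ w]) (auto simp: row_def, metis)
  also have "\<dots> = (\<Sum>x\<in>\<mu>. w (row x))"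
    using \<mu>_eq_row finite_\<mu> by (intro w_UN) (auto simp: row_def)
  finally have 1: "w V = (\<Sum>x\<in>\<mu>. w (row x))" .
  have "off \<subseteq> (\<Union>x\<in>\<mu>. oc x)"
  proof
    fix v assume v: "v \<in> off"
    then obtain x where x: "x \<in> \<mu>" "\<theta> x = \<theta> v" using perfect_col[of v] by (auto simp: off_def)
    then have "v \<in> oc x" using v by (auto simp: oc_def off_def cell_def)
    then show "v \<in> (\<Union>x\<in>\<mu>. oc x)" using x(1) by blast
  qed
  then have "w off \<le> w (\<Union>x\<in>\<mu>. oc x)" by (intro w_mono) (auto simp: oc_def)
  also have "\<dots> = (\<Sum>x\<in>\<mu>. w (oc x))"
    using \<mu>_eq_col finite_\<mu> by (intro w_UN) (auto simp: oc_def)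
  finally have 2: "w off \<le> (\<Sum>x\<in>\<mu>. w (oc x))" .
  have "w (row x) + w (oc x) < 3" if "x \<in> \<mu>" for x
  proof -
    have "w (row x) + w (oc x) = w (row x \<union> oc x)"
      by (intro w_Un[symmetric]) (auto simp: row_def oc_def)
    also have "\<dots> \<le> w (V - U x)"
      using cross[of _ x] by (intro w_mono) (auto simp: row_def oc_def)
    also have "\<dots> < 3" using light[of x] that \<mu>_N by (auto simp: w_def)
    finally show ?thesis .
  qed
  moreover have "\<mu> \<noteq> {}"
  proof
    assume "\<mu> = {}"
    then have "w V = - 2" using perfect total by (simp add: w_def)
    then show False using w_nonneg[of V] by simp
  qed
  ultimately have "(\<Sum>x\<in>\<mu>. w (row x) + w (oc x)) < (\<Sum>x\<in>\<mu>. 3)"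
    using finite_\<mu> by (intro sum_strict_mono) auto
  \<comment> \<open>The left-hand sum is at least \<open>w V + w off\<close>, and the right-hand sum
    is \<open>3 * k = w V + 2\<close>.\<close>
  then show ?thesis using 1 2 perfect total by (simp add: sum.distrib w_def)
qed

text \<open>\<open>off\<close> is a union of cells, and its weight below \<open>2\<close> leaves no
  room for two cells of weight above \<open>1\<close>.\<close>

lemma off_two_cells:
  assumes "y \<in> off" "z \<in> off" "\<phi> y \<noteq> \<phi> z" "1 < w (cell y)" "1 < w (cell z)"
  shows False
proof -
  have "w (cell y \<union> cell z) = w (cell y) + w (cell z)"
    using assms by (intro w_Un) (auto simp: cell_def)
  moreover have "w (cell y \<union> cell z) \<le> w off"
    using assms by (intro w_mono) (auto simp: off_def cell_def)
  ultimately show False using w_off assms by linarith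
qed

text \<open>Exchange \<open>x\<close> and \<open>x'\<close> for \<open>z\<close>. The
  \<open>k - 1\<close> light vertices obtained have common neighbours of weight above
  \<open>1\<close>, and the only row and column left for these are the row of \<open>x'\<close> and
  the column of \<open>x\<close>: the corner opposite \<open>z\<close> in the rectangle spanned by
  \<open>x\<close> and \<open>x'\<close>.\<close>

lemma opposite_cell:
  assumes z: "z \<in> N" and x: "x \<in> \<mu>" "\<phi> x = \<phi> z" and x': "x' \<in> \<mu>" "\<theta> x' = \<theta> z" and "x \<noteq> x'"
  shows "\<exists>u\<in>U z. \<phi> u = \<phi> x' \<and> \<theta> u = \<theta> x \<and> 1 < w (cell u)"
proof -
  define F where "F = insert z (\<mu> - {x, x'})"
  have "z \<notin> \<mu>" using \<mu>_eq_row[of x z] \<mu>_eq_col[of x' z] x x' \<open>x \<noteq> x'\<close> by auto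
  then have "card F = Suc (card (\<mu> - {x, x'}))" using finite_\<mu> by (simp add: F_def)
  moreover have "card (\<mu> - {x, x'}) = card \<mu> - 2"
    using x(1) x'(1) \<open>x \<noteq> x'\<close> finite_\<mu> by (simp add: card_Diff_subset)
  moreover have "2 \<le> card \<mu>"
    using card_mono[OF finite_\<mu>, of "{x, x'}"] x(1) x'(1) \<open>x \<noteq> x'\<close> by simp
  ultimately have "real (card F) = real k - 1" using perfect by (simp add: of_nat_diff)
  moreover define Y where "Y = {v\<in>V. \<forall>y\<in>F. v \<in> U y}"
  ultimately have Y: "1 < w Y"
    using cover[of F] \<mu>_N z by (auto simp: F_def)
  have Yc: "\<phi> v = \<phi> x' \<and> \<theta> v = \<theta> x" if v: "v \<in> Y" for v
  proof -
    obtain y where y: "y \<in> \<mu>" "\<phi> y = \<phi> v" using perfect_row[of v] v by (auto simp: Y_def)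
    obtain y' where y': "y' \<in> \<mu>" "\<theta> y' = \<theta> v" using perfect_col[of v] v by (auto simp: Y_def)
    have adj: "v \<in> U f" if "f \<in> F" for f using v that by (auto simp: Y_def)
    have "y \<notin> F" "y' \<notin> F" using adj[of y] adj[of y'] U_row[of v y] U_col[of v y'] y y' by auto
    moreover have "v \<in> U z" using adj by (simp add: F_def)
    ultimately have "y = x'" "y' = x"
      using y y' x x' U_row[of v z] U_col[of v z] by (auto simp: F_def)
    then show ?thesis using y y' by simp
  qed
  obtain u where u: "u \<in> Y" using w_pos[of Y] Y by auto
  have "Y \<subseteq> cell u" using Yc[OF u] Yc by (auto simp: cell_def Y_def)
  then have "w Y \<le> w (cell u)" using cell_sub by (intro w_mono)
  then show ?thesis using Yc[OF u] u Y by (intro bexI[of _ u]) (auto simp: Y_def F_def)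
qed

lemma off_coordinates:
  assumes "z \<in> off"
  obtains x x' where "x \<in> \<mu>" "\<phi> x = \<phi> z" "x' \<in> \<mu>" "\<theta> x' = \<theta> z" "x \<noteq> x'"
proof -
  have z: "z \<in> V" using assms by (simp add: off_def)
  obtain x x' where x: "x \<in> \<mu>" "\<phi> x = \<phi> z" "x' \<in> \<mu>" "\<theta> x' = \<theta> z"
    using perfect_row[OF z] perfect_col[OF z] by auto
  moreover have "x \<noteq> x'" using x assms by (auto simp: off_def cell_def)
  ultimately show ?thesis using that by blast
qed

lemma offI: "z \<in> V \<Longrightarrow> x \<in> \<mu> \<Longrightarrow> \<phi> z = \<phi> x \<Longrightarrow> \<theta> z \<noteq> \<theta> x \<Longrightarrow> z \<in> off"
  using \<mu>_eq_row by (auto simp: off_def cell_def)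

text \<open>A light \<open>z\<close> in \<open>off\<close> yields an opposite corner
  \<open>u\<close>, also in \<open>off\<close>, with a cell of weight above \<open>1\<close>. If
  \<open>u\<close> is light, exchanging back makes the cell of \<open>z\<close> that heavy; if
  \<open>u\<close> is heavy, its adjacency to \<open>z\<close> does. Then \<open>off\<close> weighs
  too much.\<close>

lemma off_heavy: "z \<in> off \<Longrightarrow> z \<notin> N"
proof
  assume z: "z \<in> off" and zN: "z \<in> N"
  obtain x x' where x: "x \<in> \<mu>" "\<phi> x = \<phi> z" "x' \<in> \<mu>" "\<theta> x' = \<theta> z" "x \<noteq> x'"
    using off_coordinates[OF z] .
  obtain u where u: "u \<in> U z" "\<phi> u = \<phi> x'" "\<theta> u = \<theta> x" "1 < w (cell u)"
    using opposite_cell[OF zN x] by auto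
  have uV: "u \<in> V" using u U_sub by auto
  have "\<theta> u \<noteq> \<theta> x'" using u(3) \<mu>_eq_col[OF x(1) x(3)] x(5) by auto
  then have uoff: "u \<in> off" using offI[OF uV x(3) u(2)] by simp
  have "1 < w (cell z)"
  proof (cases "u \<in> N")
    case True
    obtain z' where z': "\<phi> z' = \<phi> x" "\<theta> z' = \<theta> x'" "1 < w (cell z')"
      using opposite_cell[OF True x(3) u(2)[symmetric] x(1) u(3)[symmetric] x(5)[symmetric]] by auto
    then have "cell z' = cell z" using x by (auto simp: cell_def)
    then show ?thesis using z' by simp
  next
    case False
    then show ?thesis using heavy_cell_w[of u z] uV u(1) U_sym by blast
  qed
  then show False using off_two_cells[OF uoff z _ u(4)] U_row[OF u(1)] by blast
qed

text \<open>A vertex \<open>z\<close> of \<open>off\<close> is heavy, so it has a neighbour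
  \<open>y\<close> in the row of the member of \<open>\<mu>\<close> sharing the column of
  \<open>z\<close>. That \<open>y\<close> is again in \<open>off\<close> and heavy, so each of
  \<open>y\<close> and \<open>z\<close> makes the cell of the other weigh more than
  \<open>1\<close>.\<close>

lemma perfect_matched: "matched \<phi> \<theta> V"
proof (rule matched_cells, rule ccontr)
  fix z assume "z \<in> V" "\<not> (\<exists>x\<in>\<mu>. z \<in> cell x)"
  then have z: "z \<in> off" by (auto simp: off_def)
  then have zh: "z \<in> V - N" using off_heavy by (auto simp: off_def)
  obtain x x' where x: "x \<in> \<mu>" "\<phi> x = \<phi> z" "x' \<in> \<mu>" "\<theta> x' = \<theta> z" "x \<noteq> x'"
    using off_coordinates[OF z] .
  have "\<phi> x' \<noteq> \<phi> z" using \<mu>_eq_row[OF x(3) x(1)] x by auto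
  moreover have "\<phi> x' \<in> R" using x \<mu>_V rowR by auto
  ultimately obtain y where y: "y \<in> U z" "\<phi> y = \<phi> x'" using heavy_row[OF zh] by blast
  have yV: "y \<in> V" using y U_sub by auto
  have "\<theta> y \<noteq> \<theta> x'" using U_col[OF y(1)] x by simp
  then have yoff: "y \<in> off" using offI[OF yV x(3) y(2)] by simp
  then have yh: "y \<in> V - N" using off_heavy yV by auto
  have "z \<in> U y" using y U_sym by blast
  then show False
    using off_two_cells[OF yoff z _ heavy_cell_w[OF zh y(1)] heavy_cell_w[OF yh]] U_row[OF y(1)]
    by blast
qed

end

section \<open>Deficient case: some rows and columns without a member of the matching\<close>

context
  assumes deficient: "card \<mu> < k"
begin

text \<open>All of \<open>\<mu>\<close> has a common neighbour. By maximality it cannot be light,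
  and a heavy vertex sees only cells of weight above \<open>1\<close>.\<close>

lemma deficient_cell: "x \<in> \<mu> \<Longrightarrow> 1 < w (cell x)"
proof -
  assume x: "x \<in> \<mu>"
  then have "3 * real k - 2 - 3 * real (card \<mu>) < w {v\<in>V. \<forall>x\<in>\<mu>. v \<in> U x}"
    using \<mu>_N by (intro cover) auto
  moreover have "real (card \<mu>) + 1 \<le> real k" using deficient by simp
  ultimately have "0 < w {v\<in>V. \<forall>x\<in>\<mu>. v \<in> U x}" by linarith
  then obtain v where v: "v \<in> V" "\<And>x. x \<in> \<mu> \<Longrightarrow> v \<in> U x" using w_pos by blast
  have "v \<notin> N"
  proof
    assume "v \<in> N"
    then obtain y where "y \<in> \<mu>" "\<phi> v = \<phi> y \<or> \<theta> v = \<theta> y" using \<mu>_max by blast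
    then show False using v(2) U_row U_col by blast
  qed
  then show ?thesis using heavy_cell_w[of v x] v x U_sym by blast
qed

text \<open>Exchanging \<open>x\<close> and \<open>x'\<close> for \<open>z\<close> leaves at most
  \<open>k - 2\<close> light vertices, with common neighbours of weight above \<open>4\<close>. All
  of these lie in the row of \<open>x'\<close> or the column of \<open>x\<close>, each of which has
  weight less than \<open>2\<close> available outside the cell of \<open>x'\<close> or
  \<open>x\<close>.\<close>

lemma two_partners:
  assumes z: "z \<in> N" and x: "x \<in> \<mu>" "\<phi> x = \<phi> z" and x': "x' \<in> \<mu>" "\<theta> x' = \<theta> z" and "x \<noteq> x'"
  shows False
proof -
  define F where "F = insert z (\<mu> - {x, x'})"
  have "z \<notin> \<mu>" using \<mu>_eq_row[of x z] \<mu>_eq_col[of x' z] x x' \<open>x \<noteq> x'\<close> by auto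
  then have "card F = Suc (card (\<mu> - {x, x'}))" using finite_\<mu> by (simp add: F_def)
  moreover have "card (\<mu> - {x, x'}) = card \<mu> - 2"
    using x(1) x'(1) \<open>x \<noteq> x'\<close> finite_\<mu> by (simp add: card_Diff_subset)
  moreover have "2 \<le> card \<mu>"
    using card_mono[OF finite_\<mu>, of "{x, x'}"] x(1) x'(1) \<open>x \<noteq> x'\<close> by simp
  ultimately have "card F + 2 \<le> k" using deficient by simp
  then have cF: "real (card F) + 2 \<le> real k" by linarith
  define Y where "Y = {v\<in>V. \<forall>y\<in>F. v \<in> U y}"
  have Y: "4 < w Y"
  proof -
    have "F \<subseteq> N" "F \<noteq> {}" using \<mu>_N z by (auto simp: F_def)
    from cover[OF this] show ?thesis using cF unfolding Y_def by linarith
  qed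
  define Y1 Y2 where "Y1 = {v\<in>Y. \<phi> v = \<phi> x'}" and "Y2 = {v\<in>Y. \<theta> v = \<theta> x}"
  have adj: "v \<in> U f" if "v \<in> Y" "f \<in> F" for v f using that by (auto simp: Y_def)
  have adjz: "v \<in> U z" if "v \<in> Y" for v using adj[OF that] by (simp add: F_def)
  have "Y \<subseteq> Y1 \<union> Y2"
  proof
    fix v assume v: "v \<in> Y"
    show "v \<in> Y1 \<union> Y2"
    proof (cases "v \<in> N")
      case True
      then consider y where "y \<in> \<mu>" "\<phi> v = \<phi> y" | y where "y \<in> \<mu>" "\<theta> v = \<theta> y"
        using \<mu>_max by blast
      then show ?thesis
      proof cases
        case 1
        then have "y \<notin> F" using adj[OF v, of y] U_row[of v y] by auto
        then have "y = x'" using 1 x U_row[OF adjz[OF v]] by (auto simp: F_def)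
        then show ?thesis using 1 v by (auto simp: Y1_def)
      next
        case 2
        then have "y \<notin> F" using adj[OF v, of y] U_col[of v y] by auto
        then have "y = x" using 2 x' U_col[OF adjz[OF v]] by (auto simp: F_def)
        then show ?thesis using 2 v by (auto simp: Y2_def)
      qed
    next
      case False
      then have vh: "v \<in> V - N" using v by (auto simp: Y_def)
      have "z \<in> U v" using adjz[OF v] U_sym by blast
      moreover have "\<theta> z \<noteq> \<theta> x" using \<mu>_eq_col[OF x(1) x'(1)] x' \<open>x \<noteq> x'\<close> by auto
      ultimately have "\<theta> v = \<theta> x"
        using heavy_pinch[OF vh _ x(2)[symmetric]] x(1) \<mu>_N deficient_cell by blast
      then show ?thesis using v by (simp add: Y2_def)
    qed
  qed
  then have "w Y \<le> w (Y1 \<union> Y2)" by (intro w_mono) (auto simp: Y_def Y1_def Y2_def)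
  also have "\<dots> \<le> w Y1 + w Y2" by (rule w_Un_le)
  finally have "w Y \<le> w Y1 + w Y2" .
  moreover have "w (cell x') + w Y1 + w {} < 3"
    using x' \<mu>_N U_col[OF adjz] by (intro three_parts) (auto simp: Y1_def Y_def)
  moreover have "w (cell x) + w {} + w Y2 < 3"
    using x \<mu>_N U_row[OF adjz] by (intro three_parts) (auto simp: Y2_def Y_def)
  moreover have "w {} = 0" by (simp add: w_def)
  ultimately show False
    using Y deficient_cell[OF x(1)] deficient_cell[OF x'(1)] by linarith
qed

text \<open>Exchange only \<open>x\<close> for \<open>z\<close>. The common neighbours of the new
  set avoid the rows of \<open>\<mu>\<close>; the light ones are forced into the column of
  \<open>x\<close> by maximality, the heavy ones by \<open>heavy_pinch\<close>.\<close>

lemma one_partner: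
  assumes z: "z \<in> N" and x: "x \<in> \<mu>" "\<phi> x = \<phi> z" and nz: "\<theta> z \<notin> \<theta> ` \<mu>"
  shows "\<exists>Y\<subseteq>V. 1 < w Y \<and> (\<forall>u\<in>Y. \<theta> u = \<theta> x \<and> \<phi> u \<noteq> \<phi> x \<and> u \<in> U z \<and> \<phi> u \<notin> \<phi> ` \<mu>)"
proof -
  define F where "F = insert z (\<mu> - {x})"
  have "z \<notin> \<mu>" using nz by auto
  then have "card F = Suc (card (\<mu> - {x}))" using finite_\<mu> by (simp add: F_def)
  then have "card F = card \<mu>" using card_Suc_Diff1[OF finite_\<mu> x(1)] by simp
  then have "card F + 1 \<le> k" using deficient by simp
  then have cF: "real (card F) + 1 \<le> real k" by linarith
  define Y where "Y = {v\<in>V. \<forall>y\<in>F. v \<in> U y}"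
  have Y: "1 < w Y"
  proof -
    have "F \<subseteq> N" "F \<noteq> {}" using \<mu>_N z by (auto simp: F_def)
    from cover[OF this] show ?thesis using cF unfolding Y_def by linarith
  qed
  have "\<theta> v = \<theta> x \<and> \<phi> v \<noteq> \<phi> x \<and> v \<in> U z \<and> \<phi> v \<notin> \<phi> ` \<mu>" if v: "v \<in> Y" for v
  proof -
    have adj: "v \<in> U f" if "f \<in> F" for f using that v by (auto simp: Y_def)
    have vz: "v \<in> U z" using adj by (simp add: F_def)
    have "\<phi> v \<noteq> \<phi> x" using U_row[OF vz] x by simp
    have nrow: "\<phi> v \<notin> \<phi> ` \<mu>"
    proof
      assume "\<phi> v \<in> \<phi> ` \<mu>"
      then obtain y where y: "y \<in> \<mu>" "\<phi> v = \<phi> y" by auto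
      then have "y \<in> F" using \<open>\<phi> v \<noteq> \<phi> x\<close> by (auto simp: F_def)
      then show False using adj[of y] U_row[of v y] y by auto
    qed
    have "\<theta> v = \<theta> x"
    proof (cases "v \<in> N")
      case True
      then obtain y where y: "y \<in> \<mu>" "\<theta> v = \<theta> y" using \<mu>_max nrow by blast
      then have "y \<notin> F" using adj[of y] U_col[of v y] by auto
      then show ?thesis using y by (auto simp: F_def)
    next
      case False
      then have vh: "v \<in> V - N" using v by (auto simp: Y_def)
      have "z \<in> U v" using vz U_sym by blast
      moreover have "\<theta> z \<noteq> \<theta> x" using nz x by auto
      ultimately show ?thesis
        using heavy_pinch[OF vh _ x(2)[symmetric]] x(1) \<mu>_N deficient_cell by blast
    qed
    then show ?thesis using vz \<open>\<phi> v \<noteq> \<phi> x\<close> nrow by simp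
  qed
  then show ?thesis using Y by (intro exI[of _ Y]) (auto simp: Y_def)
qed

end

end

text \<open>The column of \<open>x\<close> gets weight above \<open>1\<close> outside its cell from
  \<open>Y\<close>. The row of \<open>x\<close> does too: from the transposed exchange at
  \<open>u\<close> if \<open>u\<close> is light, and from the cell of \<open>z\<close>, seen by
  \<open>u\<close>, if \<open>u\<close> is heavy. With the cell of \<open>x\<close> this exceeds
  \<open>3\<close>.\<close>

lemma no_single_partner:
  assumes \<mu>: "maximal_matching \<mu>" and d: "card \<mu> < k"
    and z: "z \<in> N" and x: "x \<in> \<mu>" "\<phi> x = \<phi> z" and nz: "\<theta> z \<notin> \<theta> ` \<mu>"
  shows False
proof -
  obtain Y where Y: "Y \<subseteq> V" "1 < w Y" "\<And>u. u \<in> Y \<Longrightarrow> \<theta> u = \<theta> x \<and> \<phi> u \<noteq> \<phi> x \<and> u \<in> U z \<and> \<phi> u \<notin> \<phi> ` \<mu>"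
    using one_partner[OF \<mu> d z x nz] by blast
  obtain u where u: "u \<in> Y" using w_pos[of Y] Y by auto
  have xN: "x \<in> N" using x \<mu>_N[OF \<mu>] by auto
  have cx: "1 < w (cell x)" using deficient_cell[OF \<mu> d x(1)] .
  show False
  proof (cases "u \<in> N")
    case True
    obtain Y' where Y': "Y' \<subseteq> V" "1 < w Y'" "\<And>u. u \<in> Y' \<Longrightarrow> \<phi> u = \<phi> x \<and> \<theta> u \<noteq> \<theta> x"
      using cell_system.one_partner[OF swap maximal_matching_swap[OF \<mu>] d True x(1)] Y(3)[OF u]
      by auto
    have "w (cell x) + w Y' + w Y < 3"
      using Y Y' by (intro three_parts[OF xN]) auto
    then show False using cx Y Y' by linarith
  next
    case False
    then have uh: "u \<in> V - N" using u Y by auto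
    have "z \<in> U u" using Y(3)[OF u] U_sym by blast
    then have "1 < w (cell z)" using heavy_cell_w[OF uh] by blast
    moreover have "w (cell x) + w (cell z) + w Y < 3"
      using Y x nz cell_sub by (intro three_parts[OF xN]) (auto simp: cell_def)
    ultimately show False using cx Y by linarith
  qed
qed

lemma light_in_cells:
  assumes \<mu>: "maximal_matching \<mu>" and d: "card \<mu> < k" and z: "z \<in> N"
  shows "\<exists>x\<in>\<mu>. z \<in> cell x"
proof (cases "\<phi> z \<in> \<phi> ` \<mu>")
  case True
  then obtain x where x: "x \<in> \<mu>" "\<phi> x = \<phi> z" by auto
  have "\<theta> z \<in> \<theta> ` \<mu>" using no_single_partner[OF \<mu> d z x] by auto
  then obtain x' where x': "x' \<in> \<mu>" "\<theta> x' = \<theta> z" by auto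
  have "x = x'" using two_partners[OF \<mu> d z x x'] by auto
  then have "z \<in> cell x" using x x' z N_sub by (auto simp: cell_def)
  then show ?thesis using x(1) by blast
next
  case False
  then obtain x where x: "x \<in> \<mu>" "\<theta> x = \<theta> z" using \<mu>_max[OF \<mu> z] by auto
  show ?thesis
    using cell_system.no_single_partner[OF swap maximal_matching_swap[OF \<mu>] d z x] False by auto
qed

text \<open>Otherwise \<open>z\<close> has a neighbour \<open>y\<close> in the column of
  \<open>x\<close> outside the cell of \<open>x\<close>. As light vertices lie in cells of
  \<open>\<mu>\<close>, \<open>y\<close> is heavy, and the cells of \<open>y\<close>,
  \<open>z\<close> and \<open>x\<close> overload the cross of \<open>x\<close>.\<close>

lemma heavy_in_cells:
  assumes \<mu>: "maximal_matching \<mu>" and d: "card \<mu> < k" and z: "z \<in> V - N"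
    and x: "x \<in> \<mu>" "\<phi> z = \<phi> x"
  shows "\<theta> z = \<theta> x"
proof (rule ccontr)
  assume neq: "\<theta> z \<noteq> \<theta> x"
  have xN: "x \<in> N" using x \<mu>_N[OF \<mu>] by auto
  then have "\<theta> x \<in> C" using N_sub colC by auto
  then obtain y where y: "y \<in> U z" "\<theta> y = \<theta> x" using heavy_col[OF z _ neq[symmetric]] by auto
  have yV: "y \<in> V" using y U_sub by auto
  have row: "\<phi> y \<noteq> \<phi> x" using U_row[OF y(1)] x by simp
  have "y \<notin> N"
  proof
    assume "y \<in> N"
    then obtain x1 where "x1 \<in> \<mu>" "y \<in> cell x1" using light_in_cells[OF \<mu> d] by auto
    then show False using \<mu>_eq_col[OF \<mu> x(1), of x1] y row by (auto simp: cell_def)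
  qed
  then have yh: "y \<in> V - N" using yV by auto
  have "z \<in> U y" using y U_sym by blast
  then show False
    using pinch[OF xN deficient_cell[OF \<mu> d x(1)] _ x(2) neq heavy_cell_w[OF yh] yV y(2) row
        heavy_cell_w[OF z y(1)]] z by blast
qed

lemma cells_or_heavy_block:
  assumes \<mu>: "maximal_matching \<mu>" and d: "card \<mu> < k" and v: "v \<in> V"
  shows "(\<exists>x\<in>\<mu>. v \<in> cell x) \<or> v \<notin> N \<and> \<phi> v \<notin> \<phi> ` \<mu> \<and> \<theta> v \<notin> \<theta> ` \<mu>"
proof (cases "v \<in> N")
  case True
  then show ?thesis using light_in_cells[OF \<mu> d] by auto
next
  case False
  then have vh: "v \<in> V - N" using v by auto
  have "v \<in> cell x" if "x \<in> \<mu>" "\<phi> v = \<phi> x \<or> \<theta> v = \<theta> x" for x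
    using that heavy_in_cells[OF \<mu> d vh that(1)]
      cell_system.heavy_in_cells[OF swap maximal_matching_swap[OF \<mu>] d vh that(1)] v
    by (auto simp: cell_def)
  then show ?thesis using False by blast
qed

end


section \<open>Blocks of heavy vertices\<close>

text \<open>Arithmetic for \<open>card \<mu> < m\<close>. Here \<open>q = card \<mu>\<close>,
  \<open>s = k - q\<close>, \<open>P\<close> and \<open>P'\<close> are the weights of two frame
  classes in the block, and \<open>L\<close> is the weight of the rows of \<open>\<mu>\<close>.
  Adding the last two assumptions and eliminating \<open>P + P'\<close> and \<open>L\<close> leaves
  \<open>3 * s * t + 2 * t < 4 * s\<close>, impossible for \<open>2 \<le> t\<close>.\<close>

lemma two_classes_numeric_small:
  fixes s q m t P P' L :: real
  assumes "2 \<le> t" "t \<le> 2 * s" "t = m + 1 - q" "L \<le> 3 * q"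
    "P + P' + L \<le> 3 * (s + q) - 2"
    "s * (3 * m + 1) < t * P + s * L" "s * (3 * m + 1) < t * P' + s * L"
  shows False
proof -
  have "2 * (s * (3 * m + 1)) < t * (P + P') + 2 * (s * L)"
    using assms by (simp add: algebra_simps)
  also have "\<dots> \<le> t * (3 * (s + q) - 2 - L) + 2 * (s * L)"
    using assms by (intro add_right_mono mult_left_mono) auto
  also have "\<dots> = t * (3 * (s + q) - 2) + (2 * s - t) * L" by (simp add: algebra_simps)
  also have "\<dots> \<le> t * (3 * (s + q) - 2) + (2 * s - t) * (3 * q)"
    using assms by (intro add_left_mono mult_left_mono) auto
  also have "\<dots> = t * (3 * s - 2) + 6 * (s * q)" by (simp add: algebra_simps)
  finally have "2 * (s * (3 * (t + q - 1) + 1)) < t * (3 * s - 2) + 6 * (s * q)"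
    using assms(3) by simp
  then have "3 * (s * t) + 2 * t < 4 * s" by (simp add: algebra_simps)
  moreover have "s * 2 \<le> s * t" using assms by (intro mult_left_mono) auto
  ultimately show False using assms by linarith
qed

text \<open>Arithmetic for \<open>m \<le> card \<mu>\<close>, in the same notation. The assumptions
  \<open>A\<close> and \<open>B\<close> come from taking one or two block rows among the
  \<open>m + 1\<close>. For \<open>s = 2\<close> the first pair suffices; otherwise \<open>A\<close>
  bounds the slack \<open>3 * q - L\<close> from above, \<open>B\<close> from below, and the bounds
  clash since \<open>s + q \<le> 4 * m + 2\<close>.\<close>

lemma two_classes_numeric_large:
  fixes s q m P P' L :: real
  assumes m: "1 \<le> m" "m \<le> q" and s: "2 \<le> s" "s = 2 \<or> 3 \<le> s" and k: "s + q \<le> 4 * m + 2"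
    and L: "L \<le> 3 * q" and tot: "P + P' + L \<le> 3 * (s + q) - 2"
    and A: "s * q * (3 * m + 1) < q * P + m * s * L" "s * q * (3 * m + 1) < q * P' + m * s * L"
    and B: "3 \<le> s \<Longrightarrow> s * q * (3 * m + 1) < 2 * q * P + (m - 1) * s * L"
           "3 \<le> s \<Longrightarrow> s * q * (3 * m + 1) < 2 * q * P' + (m - 1) * s * L"
  shows False
proof -
  define \<epsilon> where "\<epsilon> = 3 * q - L"
  have \<epsilon>: "0 \<le> \<epsilon>" "L = 3 * q - \<epsilon>" using L by (auto simp: \<epsilon>_def)
  have PP: "q * (P + P') \<le> q * (3 * s - 2 + \<epsilon>)"
    using tot \<epsilon> m by (intro mult_left_mono) auto
  have "2 * (s * q * (3 * m + 1)) < q * (P + P') + 2 * (m * s * L)"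
    using A by (simp add: algebra_simps)
  also have "\<dots> \<le> q * (3 * s - 2 + \<epsilon>) + 2 * (m * s * (3 * q - \<epsilon>))"
    using PP \<epsilon> by simp
  finally have A': "\<epsilon> * (2 * m * s - q) < q * (s - 2)" by (simp add: algebra_simps)
  from s(2) show False
  proof
    assume "s = 2"
    then have "0 \<le> \<epsilon> * (2 * m * s - q)" using \<epsilon> k by (intro mult_nonneg_nonneg) auto
    then show False using A' \<open>s = 2\<close> by simp
  next
    assume s3: "3 \<le> s"
    have "2 * (s * q * (3 * m + 1)) < 2 * (q * (P + P')) + 2 * ((m - 1) * s * L)"
      using B[OF s3] by (simp add: algebra_simps)
    also have "\<dots> \<le> 2 * (q * (3 * s - 2 + \<epsilon>)) + 2 * ((m - 1) * s * (3 * q - \<epsilon>))"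
      using PP \<epsilon> by simp
    finally have B': "q * (s + 2) < \<epsilon> * (q - (m - 1) * s)" by (simp add: algebra_simps)
    have "(\<epsilon> * (2 * m * s - q)) * (s + 2) < (q * (s - 2)) * (s + 2)"
      using A' s3 by (intro mult_strict_right_mono) auto
    also have "\<dots> = (q * (s + 2)) * (s - 2)" by simp
    also have "\<dots> < (\<epsilon> * (q - (m - 1) * s)) * (s - 2)"
      using B' s3 by (intro mult_strict_right_mono) auto
    finally have "\<epsilon> * ((2 * m * s - q) * (s + 2)) < \<epsilon> * ((q - (m - 1) * s) * (s - 2))"
      by (simp add: mult.assoc)
    then have "(2 * m * s - q) * (s + 2) < (q - (m - 1) * s) * (s - 2)"
      using \<epsilon>(1) by (rule mult_left_less_imp_less)
    then have "s * (2 * m * (s + 2) + (m - 1) * (s - 2)) < s * (2 * q)" by (simp add: algebra_simps)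
    then have "2 * m * (s + 2) + (m - 1) * (s - 2) < 2 * q"
      by (rule mult_left_less_imp_less) (use s3 in simp)
    moreover have "2 * m * 5 \<le> 2 * m * (s + 2)" using s3 m by (intro mult_left_mono) auto
    moreover have "0 \<le> (m - 1) * (s - 2)" using s3 m by (intro mult_nonneg_nonneg) auto
    ultimately show False using k s3 m by linarith
  qed
qed

text \<open>If the coordinates \<open>(\<phi> x, \<theta> x)\<close> of the neighbours \<open>x\<close> of \<open>v\<close> form a matching, then the
  frame of \<open>v\<close> is this matching, extended by the coordinates of \<open>v\<close>.\<close>

definition frame :: "('a \<Rightarrow> 'c) \<Rightarrow> ('a \<Rightarrow> 'c) \<Rightarrow> ('a \<Rightarrow> 'a set) \<Rightarrow> 'a \<Rightarrow> ('c \<times> 'c) set" where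
  "frame \<phi> \<theta> U v = (\<lambda>x. (\<phi> x, \<theta> x)) ` insert v (U v)"

lemma frame_functional:
  assumes "matched \<phi> \<theta> (U v)" "\<And>x. x \<in> U v \<Longrightarrow> \<phi> x \<noteq> \<phi> v \<and> \<theta> x \<noteq> \<theta> v"
    "(i, j) \<in> frame \<phi> \<theta> U v" "(i', j') \<in> frame \<phi> \<theta> U v"
  shows "i = i' \<longleftrightarrow> j = j'"
proof -
  have "matched \<phi> \<theta> (insert v (U v))"
    using assms(1) assms(2) unfolding matched_def by (metis insert_iff)
  then show ?thesis using assms(3,4) by (auto simp: frame_def matched_def)
qed

text \<open>Apart from the row of \<open>u\<close>, every row met by \<open>U v\<close> contains a
  common neighbour of \<open>u\<close> and \<open>v\<close>. Since \<open>U v\<close> is matched,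
  that common neighbour lies in the very cell seen by \<open>v\<close>.\<close>

lemma frame_subset:
  assumes mat: "matched \<phi> \<theta> (U v)" and adj: "u \<in> U v" "v \<in> U u"
    and common: "\<And>x. x \<in> U v \<Longrightarrow> \<phi> x \<noteq> \<phi> u \<Longrightarrow> \<exists>y\<in>U v \<inter> U u. \<phi> y = \<phi> x"
  shows "frame \<phi> \<theta> U v \<subseteq> frame \<phi> \<theta> U u"
proof
  fix p assume "p \<in> frame \<phi> \<theta> U v"
  then obtain x where x: "x = v \<or> x \<in> U v" "p = (\<phi> x, \<theta> x)" by (auto simp: frame_def)
  then consider "x = v" | "x \<in> U v" "\<phi> x = \<phi> u" | "x \<in> U v" "\<phi> x \<noteq> \<phi> u" by auto
  then show "p \<in> frame \<phi> \<theta> U u"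
  proof cases
    case 1
    then show ?thesis using adj x by (auto simp: frame_def)
  next
    case 2
    then have "\<theta> x = \<theta> u" using mat adj by (auto simp: matched_def)
    then show ?thesis using 2 x by (auto simp: frame_def)
  next
    case 3
    then obtain y where y: "y \<in> U v" "y \<in> U u" "\<phi> y = \<phi> x" using common by blast
    then have "\<theta> y = \<theta> x" using mat 3 by (auto simp: matched_def)
    then have "p = (\<phi> y, \<theta> y)" using x(2) y(3) by simp
    then show ?thesis using y(2) by (auto simp: frame_def)
  qed
qed

text \<open>The added assumptions come from the class bounds in links. \<open>heavy_common\<close>
  makes adjacent heavy vertices share a frame, \<open>heavy_rows\<close> bounds frame classes from
  below, and with \<open>k = m + r\<close> the bounds on \<open>k\<close> say
  \<open>2 \<le> r\<close> and \<open>r \<le> 3 * m + 2\<close>.\<close>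

locale rigid_cell_system = cell_system V N R C \<phi> \<theta> U c k
  for V N :: "'a set" and R C :: "'c set" and \<phi> \<theta> U c k +
  fixes m :: nat
  assumes heavy_rows: "v \<in> V - N \<Longrightarrow> I \<subseteq> R - {\<phi> v} \<Longrightarrow> card I = m + 1 \<Longrightarrow>
      3 * real m + 1 < c * real (card {x\<in>U v. \<phi> x \<in> I})"
    and heavy_common: "v \<in> V - N \<Longrightarrow> x \<in> U v \<Longrightarrow> i \<in> R \<Longrightarrow> i \<noteq> \<phi> v \<Longrightarrow> i \<noteq> \<phi> x \<Longrightarrow>
      \<exists>y\<in>U v \<inter> U x. \<phi> y = i"
    and k_bounds: "m + 2 \<le> k" "k \<le> 4 * m + 2" and m_pos: "v \<in> V - N \<Longrightarrow> 1 \<le> m"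
begin

abbreviation "fr \<equiv> frame \<phi> \<theta> U"

lemma frame_adjacent:
  assumes v: "v \<in> V - N" and u: "u \<in> V - N" and adj: "u \<in> U v"
  shows "fr v = fr u"
proof -
  have sub: "fr v \<subseteq> fr u" if v: "v \<in> V - N" and adj: "u \<in> U v" for u v
  proof (rule frame_subset[of \<phi> \<theta> U, OF heavy_matched[OF v] adj])
    show "v \<in> U u" using adj U_sym by blast
    show "\<exists>y\<in>U v \<inter> U u. \<phi> y = \<phi> x" if "x \<in> U v" "\<phi> x \<noteq> \<phi> u" for x
      using heavy_common[OF v adj _ U_row[OF that(1)] that(2)] subsetD[OF U_sub that(1)] rowR by blast
  qed
  have "v \<in> U u" using adj U_sym by blast
  then show ?thesis using sub[OF v adj] sub[OF u] by blast
qed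

section \<open>The heavy block and its frame classes\<close>

context
  fixes \<mu> assumes \<mu>: "maximal_matching \<mu>" and d: "card \<mu> < k"
begin

definition block :: "'a set" where "block = {v\<in>V. \<phi> v \<notin> \<phi> ` \<mu> \<and> \<theta> v \<notin> \<theta> ` \<mu>}"

lemma block_heavy: "v \<in> block \<Longrightarrow> v \<in> V - N"
  using \<mu>_max[OF \<mu>] by (auto simp: block_def)

lemma blockI: "v \<in> V \<Longrightarrow> \<phi> v \<notin> \<phi> ` \<mu> \<Longrightarrow> v \<in> block"
  using cells_or_heavy_block[OF \<mu> d, of v] by (auto simp: block_def cell_def)

definition frame_class :: "'a \<Rightarrow> 'a set" where
  "frame_class v = {u\<in>block. fr u = fr v}"

text \<open>As \<open>T\<close> omits a block row \<open>b\<close>, the class contains a vertex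
  \<open>u\<close> in row \<open>b\<close>: either \<open>v\<close> or a neighbour of
  \<open>v\<close>. All neighbours of \<open>u\<close> in the rows \<open>T\<close> stay in the
  class, so \<open>heavy_rows\<close> at \<open>u\<close> gives the bound, the rows in
  \<open>J\<close> being counted in full.\<close>

lemma frame_class_rows:
  assumes v: "v \<in> block" and T: "T \<subset> R - \<phi> ` \<mu>" and J: "J \<subseteq> \<phi> ` \<mu>" and c1: "card T + card J = m + 1"
  shows "3 * real m + 1 < (\<Sum>i\<in>T. w {x\<in>frame_class v. \<phi> x = i}) + (\<Sum>i\<in>J. w {x\<in>V. \<phi> x = i})"
proof -
  obtain b where b: "b \<in> R - \<phi> ` \<mu>" "b \<notin> T" using T by auto
  have vh: "v \<in> V - N" using block_heavy[OF v] .
  have "\<exists>u\<in>frame_class v. \<phi> u = b"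
  proof (cases "\<phi> v = b")
    case True
    then show ?thesis using v by (auto simp: frame_class_def)
  next
    case False
    then obtain u where u: "u \<in> U v" "\<phi> u = b" using heavy_row[OF vh, of b] b by auto
    then have "u \<in> V" using U_sub by blast
    then have ub: "u \<in> block" using blockI u b by auto
    then show ?thesis using frame_adjacent[OF vh block_heavy[OF ub] u(1)] u(2)
      by (auto simp: frame_class_def)
  qed
  then obtain u where u: "u \<in> frame_class v" "\<phi> u = b" by auto
  then have ub: "u \<in> block" and fu: "fr u = fr v" by (auto simp: frame_class_def)
  have finT: "finite T" by (rule finite_subset[of _ R]) (use T finR in auto)
  have finJ: "finite J" by (rule finite_subset[OF J]) (use finite_\<mu>[OF \<mu>] in simp)
  have disj: "T \<inter> J = {}" using T J by auto
  let ?A = "{x\<in>frame_class v. \<phi> x \<in> T}" and ?B = "{x\<in>V. \<phi> x \<in> J}"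
  have KV: "frame_class v \<subseteq> V" by (auto simp: frame_class_def block_def)
  then have finK: "finite (frame_class v)" using finV finite_subset by blast
  have "3 * real m + 1 < c * real (card {x\<in>U u. \<phi> x \<in> T \<union> J})"
  proof (rule heavy_rows[OF block_heavy[OF ub]])
    have "J \<subseteq> R" using J \<mu>_V[OF \<mu>] rowR by auto
    moreover have "b \<notin> J" using b J by auto
    ultimately show "T \<union> J \<subseteq> R - {\<phi> u}" using T b u(2) by auto
    show "card (T \<union> J) = m + 1" using c1 finT finJ disj by (simp add: card_Un_disjoint)
  qed
  also have "\<dots> \<le> w (?A \<union> ?B)"
  proof -
    have "{x\<in>U u. \<phi> x \<in> T \<union> J} \<subseteq> ?A \<union> ?B"
    proof
      fix x assume x: "x \<in> {x\<in>U u. \<phi> x \<in> T \<union> J}"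
      then have xV: "x \<in> V" using U_sub by blast
      show "x \<in> ?A \<union> ?B"
      proof (cases "\<phi> x \<in> T")
        case True
        then have xb: "x \<in> block" using blockI[OF xV] T by auto
        have "x \<in> U u" using x by simp
        then have "fr u = fr x" using frame_adjacent[OF block_heavy[OF ub] block_heavy[OF xb]] by simp
        then show ?thesis using xb True fu by (auto simp: frame_class_def)
      next
        case False
        then show ?thesis using x xV by auto
      qed
    qed
    then show ?thesis using w_mono[of _ "?A \<union> ?B"] KV by (auto simp: w_def)
  qed
  also have "\<dots> \<le> w ?A + w ?B" by (rule w_Un_le)
  also have "w ?A = (\<Sum>i\<in>T. w {x\<in>frame_class v. \<phi> x = i})"
    using card_classes_sum[OF finK finT] by (simp add: w_def)
  also have "w ?B = (\<Sum>i\<in>J. w {x\<in>V. \<phi> x = i})"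
    using card_classes_sum[of V J] finV finJ by (auto simp: w_def)
  finally show ?thesis by simp
qed

definition deficit :: nat where "deficit = k - card \<mu>"

text \<open>Block rows and rows of \<open>\<mu>\<close> are averaged separately, with
  \<open>a\<close> and \<open>b\<close> the weights of the chosen \<open>t\<close> and
  \<open>j\<close> rows. The plain bound on \<open>b\<close> serves the case where
  \<open>card \<mu>\<close> may be \<open>0\<close>.\<close>

lemma frame_class_average:
  assumes v: "v \<in> block" and t: "t < deficit" and j: "j \<le> card \<mu>" and tj: "t + j = m + 1"
  shows "\<exists>a b. 3 * real m + 1 < a + b \<and> real deficit * a \<le> real t * w (frame_class v) \<and>
    real (card \<mu>) * b \<le> real j * w {x\<in>V. \<phi> x \<in> \<phi> ` \<mu>} \<and> b \<le> w {x\<in>V. \<phi> x \<in> \<phi> ` \<mu>}"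
proof -
  let ?f = "\<lambda>i. w {x\<in>frame_class v. \<phi> x = i}" and ?g = "\<lambda>i. w {x\<in>V. \<phi> x = i}"
  have rows: "\<phi> ` \<mu> \<subseteq> R" using \<mu>_V[OF \<mu>] rowR by auto
  have cm: "card (\<phi> ` \<mu>) = card \<mu>" using card_image[OF \<mu>_row[OF \<mu>]] .
  have cB: "card (R - \<phi> ` \<mu>) = deficit"
    using rows finR cardR cm by (simp add: card_Diff_subset finite_subset deficit_def)
  have KV: "frame_class v \<subseteq> V" by (auto simp: frame_class_def block_def)
  then have finK: "finite (frame_class v)" using finV finite_subset by blast
  obtain T where T: "T \<subseteq> R - \<phi> ` \<mu>" "card T = t"
    "real (card (R - \<phi> ` \<mu>)) * sum ?f T \<le> real t * sum ?f (R - \<phi> ` \<mu>)"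
    using exists_light_subset[of "R - \<phi> ` \<mu>" t ?f] finR t cB by fastforce
  obtain J where J: "J \<subseteq> \<phi> ` \<mu>" "card J = j"
    "real (card (\<phi> ` \<mu>)) * sum ?g J \<le> real j * sum ?g (\<phi> ` \<mu>)"
    using exists_light_subset[of "\<phi> ` \<mu>" j ?g] finite_\<mu>[OF \<mu>] j cm by fastforce
  have "T \<noteq> R - \<phi> ` \<mu>" using T(2) t cB by auto
  then have "T \<subset> R - \<phi> ` \<mu>" using T(1) by auto
  then have "3 * real m + 1 < sum ?f T + sum ?g J"
    using frame_class_rows[OF v _ J(1)] T(2) J(2) tj by simp
  moreover have "sum ?f (R - \<phi> ` \<mu>) = w (frame_class v)"
  proof -
    have "{x\<in>frame_class v. \<phi> x \<in> R - \<phi> ` \<mu>} = frame_class v"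
      using rowR by (auto simp: frame_class_def block_def)
    then show ?thesis
      using card_classes_sum[OF finK, of "R - \<phi> ` \<mu>" c \<phi>] finR by (simp add: w_def)
  qed
  moreover have L: "sum ?g (\<phi> ` \<mu>) = w {x\<in>V. \<phi> x \<in> \<phi> ` \<mu>}"
    using card_classes_sum[of V "\<phi> ` \<mu>" c \<phi>] finV finite_\<mu>[OF \<mu>] by (simp add: w_def)
  moreover have "sum ?g J \<le> sum ?g (\<phi> ` \<mu>)"
    using J(1) finite_\<mu>[OF \<mu>] by (intro sum_mono2) auto
  ultimately show ?thesis using T(3) J(3) cB cm by (metis (no_types, lifting))
qed

text \<open>A violating pair must lie in the block and have different frames. This gives two
  disjoint frame classes, whose lower bounds cannot both fit beside the rows of
  \<open>\<mu>\<close>.\<close>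

lemma deficient_matched: "matched \<phi> \<theta> V"
proof (rule ccontr)
  assume "\<not> matched \<phi> \<theta> V"
  then obtain u v where uv: "u \<in> V" "v \<in> V" "(\<phi> u = \<phi> v) \<noteq> (\<theta> u = \<theta> v)"
    by (auto simp: matched_def)
  have diff: "False" if u: "u \<in> V" and v: "v \<in> V" and ne: "(\<phi> u = \<phi> v) \<noteq> (\<theta> u = \<theta> v)" and x: "x \<in> \<mu>" "u \<in> cell x" for u v x
  proof (cases "\<exists>y\<in>\<mu>. v \<in> cell y")
    case True
    then obtain y where y: "y \<in> \<mu>" "v \<in> cell y" by auto
    then show False using x ne \<mu>_eq_row[OF \<mu> x(1) y(1)] \<mu>_eq_col[OF \<mu> x(1) y(1)] by (auto simp: cell_def)
  next
    case False
    then have "\<phi> v \<notin> \<phi> ` \<mu>" "\<theta> v \<notin> \<theta> ` \<mu>" using cells_or_heavy_block[OF \<mu> d v] by auto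
    moreover have "\<phi> u \<in> \<phi> ` \<mu>" "\<theta> u \<in> \<theta> ` \<mu>" using x by (auto simp: cell_def)
    ultimately show False using ne by metis
  qed
  have "(\<phi> v = \<phi> u) \<noteq> (\<theta> v = \<theta> u)" using uv(3) by (simp add: eq_commute)
  then have ub: "u \<in> block" and vb: "v \<in> block"
    using cells_or_heavy_block[OF \<mu> d uv(1)] cells_or_heavy_block[OF \<mu> d uv(2)] uv
      diff[OF uv] diff[OF uv(2,1)] by (auto simp: block_def)
  have uh: "u \<in> V - N" and vh: "v \<in> V - N" using block_heavy ub vb by auto
  have "fr u \<noteq> fr v"
  proof
    assume "fr u = fr v"
    then have "(\<phi> u, \<theta> u) \<in> fr v" "(\<phi> v, \<theta> v) \<in> fr v" by (auto simp: frame_def)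
    then show False using frame_functional[of \<phi> \<theta> U v, OF heavy_matched[OF vh]] U_row U_col uv(3) by blast
  qed
  define P P' L where "P = w (frame_class u)" and "P' = w (frame_class v)"
    and "L = w {x\<in>V. \<phi> x \<in> \<phi> ` \<mu>}"
  define q where "q = card \<mu>"
  have sq: "deficit + q = k" using d by (simp add: q_def deficit_def)
  have "2 \<le> deficit"
  proof -
    have two: "2 \<le> card A" if "finite A" "x \<in> A" "y \<in> A" "x \<noteq> y" for A :: "'c set" and x y
      using card_mono[OF that(1), of "{x, y}"] that by simp
    have "card (R - \<phi> ` \<mu>) = deficit"
      using \<mu>_V[OF \<mu>] rowR finR cardR card_image[OF \<mu>_row[OF \<mu>]] finite_\<mu>[OF \<mu>]
      by (subst card_Diff_subset) (auto simp: deficit_def)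
    moreover have "card (C - \<theta> ` \<mu>) = deficit"
      using \<mu>_V[OF \<mu>] colC finC cardC card_image[OF \<mu>_col[OF \<mu>]] finite_\<mu>[OF \<mu>]
      by (subst card_Diff_subset) (auto simp: deficit_def)
    moreover have "\<phi> u \<noteq> \<phi> v \<or> \<theta> u \<noteq> \<theta> v" using uv(3) by auto
    ultimately show ?thesis
      using two[of "R - \<phi> ` \<mu>" "\<phi> u" "\<phi> v"] two[of "C - \<theta> ` \<mu>" "\<theta> u" "\<theta> v"] ub vb finR finC rowR colC
      by (auto simp: block_def)
  qed
  have m1: "1 \<le> m" using m_pos[OF uh] .
  have "w (frame_class u \<union> frame_class v) = P + P'"
    unfolding P_def P'_def using \<open>fr u \<noteq> fr v\<close>
    by (intro w_Un) (auto simp: frame_class_def block_def)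
  moreover have "w (frame_class u \<union> frame_class v \<union> {x\<in>V. \<phi> x \<in> \<phi> ` \<mu>})
      = w (frame_class u \<union> frame_class v) + L"
    unfolding L_def by (intro w_Un) (auto simp: frame_class_def block_def)
  moreover have "w (frame_class u \<union> frame_class v \<union> {x\<in>V. \<phi> x \<in> \<phi> ` \<mu>}) \<le> w V"
    by (intro w_mono) (auto simp: frame_class_def block_def)
  moreover have "real deficit + real q = real k" using sq by (metis of_nat_add)
  ultimately have tot: "P + P' + L \<le> 3 * (real deficit + real q) - 2"
    using total by (simp add: w_def)
  have L3: "L \<le> 3 * real q"
  proof -
    have "w {x\<in>V. \<phi> x = i} \<le> 3" if i: "i \<in> \<phi> ` \<mu>" for i
    proof -
      obtain y where y: "y \<in> \<mu>" "i = \<phi> y" using i by auto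
      have "w {x\<in>V. \<phi> x = i} \<le> w (V - U y)" using y cross[of _ y] by (intro w_mono) auto
      then show ?thesis using light[of y] y \<mu>_N[OF \<mu>] by (auto simp: w_def)
    qed
    then have "(\<Sum>i\<in>\<phi> ` \<mu>. w {x\<in>V. \<phi> x = i}) \<le> (\<Sum>i\<in>\<phi> ` \<mu>. 3)" by (intro sum_mono)
    also have "\<dots> = 3 * real q" using card_image[OF \<mu>_row[OF \<mu>]] by (simp add: q_def)
    finally show ?thesis
      unfolding L_def using card_classes_sum[of V "\<phi> ` \<mu>" c \<phi>] finV finite_\<mu>[OF \<mu>] by (simp add: w_def)
  qed
  show False
  proof (cases "q < m")
    case True
    \<comment> \<open>All \<open>q\<close> rows of \<open>\<mu>\<close> are used, and
      \<open>t\<close> block rows complete them to \<open>m + 1\<close>.\<close>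
    define t where "t = m + 1 - q"
    have t: "t < deficit" "t + q = m + 1" "2 \<le> t" using True sq k_bounds(1) by (auto simp: t_def)
    have bound: "real deficit * (3 * real m + 1) < real t * w (frame_class x) + real deficit * L"
      if x: "x \<in> block" for x
    proof -
      obtain a b where ab: "3 * real m + 1 < a + b" "real deficit * a \<le> real t * w (frame_class x)" "b \<le> L"
        using frame_class_average[OF x t(1), of q] t(2) by (auto simp: q_def L_def)
      have "real deficit * (3 * real m + 1) < real deficit * (a + b)"
        using ab(1) \<open>2 \<le> deficit\<close> by (intro mult_strict_left_mono) auto
      moreover have "real deficit * b \<le> real deficit * L" using ab(3) by (intro mult_left_mono) auto
      ultimately show ?thesis using ab(2) by (simp add: distrib_left)
    qed
    have "real t = real m + 1 - real q" using t(2) by linarith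
    moreover have "real t \<le> 2 * real deficit" "2 \<le> real t" using t by linarith+
    ultimately show False
      using two_classes_numeric_small[of "real t" "real deficit" "real m" "real q" L P P'] L3 tot
        bound[OF ub] bound[OF vb] by (simp add: P_def P'_def)
  next
    case False
    then have qm: "m \<le> q" by simp
    have bound: "real deficit * real q * (3 * real m + 1) < real t * real q * w (frame_class x) + real j * real deficit * L"
      if x: "x \<in> block" and t: "t < deficit" and tj: "t + j = m + 1" and j: "j \<le> q" for x t j
    proof -
      obtain a b where ab: "3 * real m + 1 < a + b" "real deficit * a \<le> real t * w (frame_class x)"
        "real q * b \<le> real j * L"
        using frame_class_average[OF x t _ tj] j by (auto simp: q_def L_def)
      have "(real deficit * real q) * (3 * real m + 1) < (real deficit * real q) * (a + b)"
        using ab(1) \<open>2 \<le> deficit\<close> qm m1 by (intro mult_strict_left_mono) auto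
      moreover have "real q * (real deficit * a) \<le> real q * (real t * w (frame_class x))"
        using ab(2) by (intro mult_left_mono) auto
      moreover have "real deficit * (real q * b) \<le> real deficit * (real j * L)"
        using ab(3) by (intro mult_left_mono) auto
      ultimately show ?thesis by (simp add: algebra_simps)
    qed
    have "real deficit * real q * (3 * real m + 1) < real q * w (frame_class x) + real m * real deficit * L"
      if "x \<in> block" for x
      using bound[OF that, of 1 m] \<open>2 \<le> deficit\<close> qm by simp
    \<comment> \<open>Two block rows may be chosen only if a third exists, because \<open>T\<close>
      has to omit one.\<close>
    moreover have "real deficit * real q * (3 * real m + 1) < 2 * real q * w (frame_class x) + (real m - 1) * real deficit * L"
      if "x \<in> block" "3 \<le> real deficit" for x
      using bound[OF that(1), of 2 "m - 1"] that(2) qm m1 by (simp add: of_nat_diff)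
    moreover have "deficit = 2 \<or> 3 \<le> deficit" using \<open>2 \<le> deficit\<close> by linarith
    then have "real deficit = 2 \<or> 3 \<le> real deficit" by auto
    moreover have "real deficit + real q \<le> 4 * real m + 2" using sq k_bounds(2) by linarith
    ultimately show False
      using two_classes_numeric_large[of "real m" "real q" "real deficit" L P P'] m1 qm \<open>2 \<le> deficit\<close> L3 tot ub vb
      by (simp add: P_def P'_def)
  qed
qed

end

theorem cells_matched: "matched \<phi> \<theta> V"
proof -
  obtain \<mu> where \<mu>: "maximal_matching \<mu>" using maximal_matching_exists by auto
  have "card (\<phi> ` \<mu>) \<le> card R" using \<mu>_V[OF \<mu>] rowR finR by (intro card_mono) auto
  then have "card \<mu> \<le> k" using card_image[OF \<mu>_row[OF \<mu>]] cardR by simp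
  then show ?thesis
    using perfect_matched[OF \<mu>] deficient_matched[OF \<mu>] by (cases "card \<mu> = k") auto
qed

end


section \<open>Rigidity of colourings\<close>

text \<open>Averaging with \<open>T = {i}\<close>: the total \<open>3 * (m + r) - 5\<close>, which
  is \<open>3\<close> less than \<open>3 * k - 2\<close>, makes the estimate collapse to
  \<open>r - 2 < (r - 2) * f i\<close>.\<close>

lemma class_weight_gt_one:
  fixes f :: "'c \<Rightarrow> real"
  assumes Q: "finite Q" "card Q + 1 = m + r" and r: "3 \<le> r" and i: "i \<in> Q"
    and large: "\<And>I. I \<subseteq> Q \<Longrightarrow> card I = m + 1 \<Longrightarrow> 3 * real m + 1 < sum f I"
    and tot: "sum f Q \<le> 3 * (real m + real r) - 5"
  shows "1 < f i"
proof -
  have "(3 * real m + 1) * real (card Q - card {i}) <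
      sum f {i} * real (card Q - card {i}) + real m * sum f (Q - {i})"
    by (rule subset_sum_average) (use Q r i large in auto)
  moreover have "real (card Q - card {i}) = real m + real r - 2" using Q r by (simp add: of_nat_diff)
  moreover have "sum f (Q - {i}) = sum f Q - f i" using Q i by (simp add: sum_diff1)
  ultimately have "(3 * real m + 1) * (real m + real r - 2) <
      f i * (real m + real r - 2) + real m * (sum f Q - f i)" by simp
  also have "\<dots> \<le> f i * (real m + real r - 2) + real m * (3 * (real m + real r) - 5 - f i)"
    using tot by (intro add_left_mono mult_left_mono) auto
  finally have "(real r - 2) * 1 < (real r - 2) * f i" by (simp add: algebra_simps)
  then show ?thesis by (rule mult_left_less_imp_less) (use r in simp)
qed

text \<open>Meant for class weights \<open>f\<close> in \<open>U v\<close> and \<open>g\<close> in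
  \<open>U v \<inter> U x\<close>, with \<open>l\<close> the colour of \<open>x\<close>. If
  \<open>g i = 0\<close>, then already \<open>m\<close> classes other than \<open>i\<close> and
  \<open>l\<close> have \<open>f\<close>-weight above \<open>3 * m + 1\<close>, so those classes are
  heavy in total; averaging with \<open>T = {i, l}\<close> bounds the same total from above.\<close>

lemma common_class_nonzero:
  fixes f g :: "'c \<Rightarrow> real"
  assumes Q: "finite Q" "card Q + 1 = m + r" and r: "3 \<le> r" and m: "1 \<le> m"
    and i: "i \<in> Q" and l: "l \<in> Q" and "i \<noteq> l"
    and large: "\<And>I. I \<subseteq> Q \<Longrightarrow> card I = m + 1 \<Longrightarrow> 3 * real m + 1 < sum f I"
    and large': "\<And>I. I \<subseteq> Q - {l} \<Longrightarrow> card I = m + 1 \<Longrightarrow> 3 * real m + 1 < sum g I"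
    and tot: "sum f Q \<le> 3 * (real m + real r) - 5" and gf: "\<And>x. g x \<le> f x"
  shows "g i \<noteq> 0"
proof
  assume gi: "g i = 0"
  let ?Q = "Q - {i, l}"
  have cQ: "card ?Q = m + r - 3" using Q i l \<open>i \<noteq> l\<close> r by (simp add: card_Diff_subset)
  have rc: "real (m + r - 3) = real m + real r - 3" using r by (simp add: of_nat_diff)
  have "(3 * real m + 1) * real (card ?Q - card ({} :: 'c set)) <
      sum f {} * real (card ?Q - card ({} :: 'c set)) + real m * sum f (?Q - {})"
  proof (rule subset_sum_average)
    show "3 * real m + 1 < sum f I" if I: "I \<subseteq> ?Q" "card I = card ({} :: 'c set) + m" for I
    proof -
      have finI: "finite I" using I(1) Q finite_subset by blast
      have "3 * real m + 1 < sum g (insert i I)"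
        using I finI i \<open>i \<noteq> l\<close> by (intro large') (auto simp: card_insert_if)
      also have "\<dots> = sum g I" using I(1) finI gi by (subst sum.insert) auto
      also have "\<dots> \<le> sum f I" using gf by (intro sum_mono)
      finally show ?thesis .
    qed
  qed (use Q cQ r m in auto)
  then have 1: "(3 * real m + 1) * (real m + real r - 3) < real m * sum f ?Q" using cQ rc by simp
  have "(3 * real m + 1) * real (card Q - card {i, l}) <
      sum f {i, l} * real (card Q - card {i, l}) + real (m - 1) * sum f (Q - {i, l})"
    by (rule subset_sum_average) (use Q r i l \<open>i \<noteq> l\<close> m large in auto)
  moreover have "real (card Q - card {i, l}) = real m + real r - 3"
    using Q r \<open>i \<noteq> l\<close> by (simp add: of_nat_diff)
  moreover have "sum f Q = sum f {i, l} + sum f ?Q"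
    using Q i l by (intro sum.subset_diff[of "{i, l}", THEN trans]) auto
  ultimately have "(3 * real m + 1) * (real m + real r - 3) <
      (sum f Q - sum f ?Q) * (real m + real r - 3) + (real m - 1) * sum f ?Q"
    using m by (simp add: of_nat_diff)
  also have "\<dots> \<le> (3 * (real m + real r) - 5 - sum f ?Q) * (real m + real r - 3) + (real m - 1) * sum f ?Q"
    using tot r by (intro add_right_mono mult_right_mono) auto
  finally have "(real r - 2) * sum f ?Q < (real r - 2) * (3 * (real m + real r - 3))"
    by (simp add: algebra_simps)
  then have 2: "sum f ?Q < 3 * (real m + real r - 3)"
    by (rule mult_left_less_imp_less) (use r in simp)
  have "real m * sum f ?Q \<le> real m * (3 * (real m + real r - 3))"
    using 2 by (intro mult_left_mono) auto
  then have "(3 * real m + 1) * (real m + real r - 3) < real m * (3 * (real m + real r - 3))" using 1 by linarith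
  then have "real m + real r - 3 < 0" by (simp add: algebra_simps)
  then show False using r m by linarith
qed

text \<open>Induction through links with the vertex weight and the palettes generalised: in the link
  of a heavy vertex the total drops by at least \<open>3\<close>, just as
  \<open>3 * (m + r) - 2\<close> does, while \<open>m\<close> and \<open>d\<close> stay.\<close>

theorem coloring_rigid_dense:
  assumes "2 \<le> r" "r \<le> 3 * m + 2" "codegree_graph r d V E"
    "proper_coloring R V E \<phi>" "proper_coloring C V E \<theta>" "finite R" "finite C"
    "card R = m + r" "card C = m + r"
    "0 < c" "c * real (card V) \<le> 3 * (real m + real r) - 2" "3 * real m + 1 < c * real d"
  shows "matched \<phi> \<theta> V"
  using assms
proof (induction r arbitrary: V E R C c)
  case 0
  then show ?case by simp
next
  case (Suc r')
  define r where "r = Suc r'"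
  define k where "k = m + r"
  note IH = Suc.IH
  have r2: "2 \<le> r" and r3: "r \<le> 3 * m + 2" and G: "codegree_graph r d V E"
    and col: "proper_coloring R V E \<phi>" "proper_coloring C V E \<theta>" and fin: "finite R" "finite C"
    and cards: "card R = k" "card C = k" and c0: "0 < c"
    and tot0: "c * real (card V) \<le> 3 * (real m + real r) - 2" and deg0: "3 * real m + 1 < c * real d"
    using Suc.prems by (simp_all add: r_def k_def)
  have finV: "finite V" using G by (auto simp: codegree_graph_def)
  show ?case
  proof (cases "V = {}")
    case True
    then show ?thesis by (simp add: matched_def)
  next
    case False
    then have cV: "0 < real (card V)" using finV by (simp add: card_gt_0_iff)
    \<comment> \<open>Raising the vertex weight to make the total exactly \<open>3 * k - 2\<close>
      only strengthens the codegree bound.\<close>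
    define b where "b = (3 * real k - 2) / real (card V)"
    have tot: "b * real (card V) = 3 * real k - 2" using cV by (simp add: b_def)
    have "c \<le> b" using tot0 cV by (simp add: b_def k_def pos_le_divide_eq)
    then have b0: "0 < b" using c0 by simp
    have "c * real d \<le> b * real d" using \<open>c \<le> b\<close> by (intro mult_right_mono) auto
    then have deg: "3 * real m + 1 < b * real d" using deg0 by linarith
    define U where "U = nbhd E"
    have UV: "U v \<subseteq> V" for v using nbhd_subset[OF G] by (simp add: U_def)
    have finU: "finite (U v)" for v using UV finV finite_subset by blast
    define N where "N = {v\<in>V. b * real (card (V - U v)) < 3}"
    have large: "3 * real m + 1 < (\<Sum>i\<in>I. b * real (card {x\<in>U v. \<psi> x = i}))"
      if v: "v \<in> V" and psi: "proper_coloring S V E \<psi>" "finite S" "card S = k"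
        and I: "I \<subseteq> S - {\<psi> v}" "card I = m + 1" for v I \<psi> and S :: "'b set"
    proof -
      have "real d \<le> real (card {x\<in>U v. \<psi> x \<in> I})"
        using codegree_le_nbhd_classes[OF G psi(1,2) r2 v I(1)] I(2) psi(3) by (simp add: k_def U_def)
      then have "b * real d \<le> b * real (card {x\<in>U v. \<psi> x \<in> I})" using b0 by simp
      moreover have "finite I" using I(1) psi(2) finite_subset by blast
      ultimately show ?thesis using deg card_classes_sum[OF finU, of I b v \<psi>] by linarith
    qed
    have heavy: "3 \<le> r \<and> b * real (card (U v)) \<le> 3 * (real m + real r) - 5" if v: "v \<in> V - N" for v
    proof -
      have "card (V - U v) = card V - card (U v)" using UV finU by (simp add: card_Diff_subset)
      moreover have "card (U v) \<le> card V" using UV finV by (simp add: card_mono)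
      ultimately have "b * real (card (V - U v)) = b * real (card V) - b * real (card (U v))"
        by (simp add: of_nat_diff algebra_simps)
      then have le: "b * real (card (U v)) \<le> 3 * (real m + real r) - 5"
        using v tot by (auto simp: N_def k_def)
      \<comment> \<open>For \<open>r = 2\<close> the \<open>m + 1\<close> colours other than that of
        \<open>v\<close> make \<open>U v\<close> weigh more than \<open>3 * m + 1\<close>, which is
        the upper bound \<open>3 * (m + r) - 5\<close>.\<close>
      have "r \<noteq> 2"
      proof
        assume r: "r = 2"
        have vR: "\<phi> v \<in> R" using v col(1) by (auto simp: proper_coloring_def)
        then have "card (R - {\<phi> v}) = m + 1" using fin cards r by (simp add: k_def)
        then have "d \<le> card {x\<in>U v. \<phi> x \<in> R - {\<phi> v}}"
          using codegree_le_nbhd_classes[OF G col(1) fin(1) r2, of v "R - {\<phi> v}"] v cards r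
          by (simp add: k_def U_def)
        also have "\<dots> \<le> card (U v)" using finU by (intro card_mono) auto
        finally have "b * real d \<le> b * real (card (U v))" using b0 by simp
        then show False using le deg r by simp
      qed
      then show ?thesis using le r2 by simp
    qed
    have class_tot: "(\<Sum>i\<in>S - {\<psi> v}. b * real (card {x\<in>U v. \<psi> x = i})) \<le> 3 * (real m + real r) - 5"
      if v: "v \<in> V - N" and psi: "proper_coloring S V E \<psi>" "finite S" for v \<psi> and S :: "'b set"
    proof -
      have "real (card {x\<in>U v. \<psi> x \<in> S - {\<psi> v}}) \<le> real (card (U v))"
        using finU by (simp add: card_mono)
      then have "b * real (card {x\<in>U v. \<psi> x \<in> S - {\<psi> v}}) \<le> b * real (card (U v))" using b0 by simp
      then show ?thesis
        using heavy[OF v] card_classes_sum[OF finU, of "S - {\<psi> v}" b v \<psi>] psi(2) by simp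
    qed
    have card_S: "card (S - {\<psi> v}) + 1 = m + r"
      if "v \<in> V" "proper_coloring S V E \<psi>" "finite S" "card S = k" for v \<psi> and S :: "'b set"
    proof -
      have "\<psi> v \<in> S" using that by (auto simp: proper_coloring_def)
      then show ?thesis using card_Suc_Diff1[of S "\<psi> v"] that by (simp add: k_def)
    qed
    have class_gt: "1 < b * real (card {x\<in>U v. \<psi> x = i})"
      if v: "v \<in> V - N" and psi: "proper_coloring S V E \<psi>" "finite S" "card S = k"
        and i: "i \<in> S" "i \<noteq> \<psi> v" for v i \<psi> and S :: "'b set"
    proof (rule class_weight_gt_one[of "S - {\<psi> v}" m r i])
      show "3 * real m + 1 < (\<Sum>i\<in>I. b * real (card {x\<in>U v. \<psi> x = i}))"
        if "I \<subseteq> S - {\<psi> v}" "card I = m + 1" for I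
        using large[OF _ psi that] v by blast
    qed (use heavy[OF v] class_tot[OF v psi(1,2)] card_S[OF _ psi] v psi(2) i in auto)
    have link_matched: "matched \<phi> \<theta> (U v)" if v: "v \<in> V - N" for v
    proof -
      have r': "2 \<le> r'" "r' \<le> 3 * m + 2" using heavy[OF v] r3 by (auto simp: r_def)
      show ?thesis
        unfolding U_def
      proof (rule IH[OF r' codegree_graph_link proper_coloring_link[OF G col(1)]
            proper_coloring_link[OF G col(2)]])
        show "codegree_graph (Suc r') d V E" using G by (simp add: r_def)
        show "card (R - {\<phi> v}) = m + r'" "card (C - {\<theta> v}) = m + r'"
          using card_S[OF _ col(1) fin(1) cards(1)] card_S[OF _ col(2) fin(2) cards(2)] v
          by (auto simp: r_def)
        show "b * real (card (nbhd E v)) \<le> 3 * (real m + real r') - 2"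
          using heavy[OF v] by (simp add: U_def r_def)
      qed (use fin b0 deg r' in auto)
    qed
    have hit: "\<exists>x\<in>U v. \<psi> x = i"
      if v: "v \<in> V - N" and psi: "proper_coloring S V E \<psi>" "finite S" "card S = k"
        and i: "i \<in> S" "i \<noteq> \<psi> v" for v i \<psi> and S :: "'b set"
    proof -
      have "card {x\<in>U v. \<psi> x = i} \<noteq> 0" using class_gt[OF v psi i] by (intro notI) simp
      then show ?thesis by (metis (mono_tags, lifting) card.empty empty_Collect_eq)
    qed
    have "rigid_cell_system V N R C \<phi> \<theta> U b k m"
    proof (unfold_locales)
      show "u \<in> U v \<longleftrightarrow> v \<in> U u" for u v by (simp add: U_def nbhd_sym)
      show "\<phi> u \<noteq> \<phi> v" "\<theta> u \<noteq> \<theta> v" if "u \<in> U v" for u v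
        using that nbhd_color_neq[OF col(1)] nbhd_color_neq[OF col(2)] by (auto simp: U_def)
      show "1 < b * real (card {y\<in>V. \<phi> y = \<phi> x \<and> \<theta> y = \<theta> x})"
        if v: "v \<in> V - N" and x: "x \<in> U v" for v x
      proof -
        have "\<phi> x \<in> R" "\<phi> x \<noteq> \<phi> v"
          using x subsetD[OF UV x] col(1) nbhd_color_neq[OF col(1)] by (auto simp: proper_coloring_def U_def)
        then have "1 < b * real (card {y\<in>U v. \<phi> y = \<phi> x})"
          using class_gt[OF v col(1) fin(1) cards(1)] by blast
        \<comment> \<open>Since \<open>U v\<close> is matched, each of its row classes lies in one
          cell.\<close>
        moreover have "{y\<in>U v. \<phi> y = \<phi> x} \<subseteq> {y\<in>V. \<phi> y = \<phi> x \<and> \<theta> y = \<theta> x}"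
          using link_matched[OF v] x UV unfolding matched_def by blast
        then have "real (card {y\<in>U v. \<phi> y = \<phi> x}) \<le> real (card {y\<in>V. \<phi> y = \<phi> x \<and> \<theta> y = \<theta> x})"
          using finV by (simp add: card_mono)
        then have "b * real (card {y\<in>U v. \<phi> y = \<phi> x}) \<le> b * real (card {y\<in>V. \<phi> y = \<phi> x \<and> \<theta> y = \<theta> x})"
          using b0 by simp
        ultimately show ?thesis by linarith
      qed
      show "3 * real m + 1 < b * real (card {x\<in>U v. \<phi> x \<in> I})"
        if v: "v \<in> V - N" and I: "I \<subseteq> R - {\<phi> v}" "card I = m + 1" for v I
      proof -
        have "finite I" using I(1) fin finite_subset by blast
        then show ?thesis
          using large[OF _ col(1) fin(1) cards(1) I] v card_classes_sum[OF finU, of I b v \<phi>] by simp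
      qed
      show "1 \<le> m" if "v \<in> V - N" for v using heavy[OF that] r3 by linarith
      show "\<exists>y\<in>U v \<inter> U x. \<phi> y = i"
        if v: "v \<in> V - N" and x: "x \<in> U v" and i: "i \<in> R" "i \<noteq> \<phi> v" "i \<noteq> \<phi> x" for v x i
      proof -
        have vV: "v \<in> V" and r3': "3 \<le> r" using v heavy[OF v] by auto
        have m1: "1 \<le> m" using r3 r3' by linarith
        let ?g = "\<lambda>i. b * real (card {y\<in>U v \<inter> U x. \<phi> y = i})"
        have "\<phi> x \<in> R" "\<phi> x \<noteq> \<phi> v"
          using x subsetD[OF UV x] col(1) nbhd_color_neq[OF col(1)] by (auto simp: proper_coloring_def U_def)
        have "?g i \<noteq> 0"
        proof (rule common_class_nonzero[OF _ _ r3' m1 _ _ i(3), of "R - {\<phi> v}" "\<lambda>i. b * real (card {y\<in>U v. \<phi> y = i})"])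
          show "3 * real m + 1 < (\<Sum>i\<in>I. b * real (card {x\<in>U v. \<phi> x = i}))"
            if "I \<subseteq> R - {\<phi> v}" "card I = m + 1" for I
            using large[OF vV col(1) fin(1) cards(1) that] .
          show "3 * real m + 1 < sum ?g I" if I: "I \<subseteq> R - {\<phi> v} - {\<phi> x}" "card I = m + 1" for I
          proof -
            have "real d \<le> real (card {y\<in>U v \<inter> U x. \<phi> y \<in> I})"
              using codegree_le_common_nbhd_classes[OF G col(1) fin(1) r3' vV, of x I] x I cards
              by (auto simp: U_def k_def)
            then have "b * real d \<le> b * real (card {y\<in>U v \<inter> U x. \<phi> y \<in> I})" using b0 by simp
            moreover have "finite I" using I(1) fin finite_subset by blast
            ultimately show ?thesis
              using deg card_classes_sum[of "U v \<inter> U x" I b \<phi>] finU by simp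
          qed
          show "?g j \<le> b * real (card {y\<in>U v. \<phi> y = j})" for j
            using b0 finU by (auto intro!: card_mono)
        qed (use fin heavy[OF v] class_tot[OF v col(1) fin(1)] card_S[OF vV col(1) fin(1) cards(1)]
            i \<open>\<phi> x \<in> R\<close> \<open>\<phi> x \<noteq> \<phi> v\<close> in auto)
        then have "card {y\<in>U v \<inter> U x. \<phi> y = i} \<noteq> 0" by auto
        then show ?thesis by (metis (mono_tags, lifting) card.empty empty_Collect_eq)
      qed
      show "v \<in> V \<Longrightarrow> \<phi> v \<in> R" "v \<in> V \<Longrightarrow> \<theta> v \<in> C" for v
        using col by (auto simp: proper_coloring_def)
      show "m + 2 \<le> k" "k \<le> 4 * m + 2" using r2 r3 by (auto simp: k_def)
    qed (use finV fin cards UV b0 tot link_matched hit[OF _ col(1) fin(1) cards(1)]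
        hit[OF _ col(2) fin(2) cards(2)] in \<open>auto simp: N_def\<close>)
    then show ?thesis by (rule rigid_cell_system.cells_matched)
  qed
qed


text \<open>The induction starts at \<open>r = 3 * m + 2\<close>, where both threshold ratios equal
  \<open>1 / 4\<close>. In the link of a heavy vertex the total now drops by at least
  \<open>1\<close>.\<close>

theorem coloring_rigid_sparse:
  assumes "3 * m + 2 \<le> r" "codegree_graph r d V E"
    "proper_coloring R V E \<phi>" "proper_coloring C V E \<theta>" "finite R" "finite C"
    "card R = m + r" "card C = m + r"
    "0 < c" "c * real (card V) \<le> real m + real r + 2" "real m + 1 < c * real d"
  shows "matched \<phi> \<theta> V"
  using assms
proof (induction r arbitrary: V E R C c rule: dec_induct)
  case base
  \<comment> \<open>This factor takes the codegree threshold \<open>m + 1\<close> to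
    \<open>3 * m + 1\<close> and the total \<open>4 * (m + 1)\<close> to
    \<open>4 * (3 * m + 1)\<close>, the normalisation of the dense case.\<close>
  define a where "a = (3 * real m + 1) / (real m + 1)"
  have a0: "0 < a" and am: "a * (real m + 1) = 3 * real m + 1" by (simp_all add: a_def add_pos_pos)
  show ?case
  proof (rule coloring_rigid_dense[of "3 * m + 2" m d V E R \<phi> C \<theta> "a * c"])
    have "a * (c * real (card V)) \<le> a * (4 * (real m + 1))"
      using base a0 by (intro mult_left_mono) auto
    also have "\<dots> = 4 * (a * (real m + 1))" by simp
    also have "\<dots> = 3 * (real m + real (3 * m + 2)) - 2" unfolding am by simp
    finally show "a * c * real (card V) \<le> 3 * (real m + real (3 * m + 2)) - 2"
      by (simp only: mult.assoc)
    have "a * (real m + 1) < a * (c * real d)"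
      using base a0 by (intro mult_strict_left_mono) auto
    then show "3 * real m + 1 < a * c * real d" unfolding am by (simp only: mult.assoc)
  qed (use base a0 in auto)
next
  case (step r')
  define r where "r = Suc r'"
  define k where "k = m + r"
  note IH = step.IH
  have r3: "3 * m + 3 \<le> r" and G: "codegree_graph r d V E"
    and col: "proper_coloring R V E \<phi>" "proper_coloring C V E \<theta>" and fin: "finite R" "finite C"
    and cards: "card R = k" "card C = k" and c0: "0 < c"
    and tot0: "c * real (card V) \<le> real k + 2" and deg0: "real m + 1 < c * real d"
    using step.prems step.hyps by (simp_all add: r_def k_def)
  have finV: "finite V" and edge: "\<And>e. e \<in> E \<Longrightarrow> e \<subseteq> V \<and> card e = r"
    and covered: "\<And>v. v \<in> V \<Longrightarrow> \<exists>e\<in>E. v \<in> e"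
    using G by (auto simp: codegree_graph_def)
  show ?case
  proof (rule ccontr)
    assume nm: "\<not> matched \<phi> \<theta> V"
    then have "V \<noteq> {}" by (auto simp: matched_def)
    then have cV: "0 < real (card V)" using finV by (simp add: card_gt_0_iff)
    define b where "b = (real k + 2) / real (card V)"
    have tot: "b * real (card V) = real k + 2" using cV by (simp add: b_def)
    have "c \<le> b" using tot0 cV by (simp add: b_def pos_le_divide_eq)
    then have b0: "0 < b" using c0 by simp
    have "c * real d \<le> b * real d" using \<open>c \<le> b\<close> by (intro mult_right_mono) auto
    then have deg: "real m + 1 < b * real d" using deg0 by linarith
    define U where "U = nbhd E"
    have UV: "U v \<subseteq> V" for v using nbhd_subset[OF G] by (simp add: U_def)
    have finU: "finite (U v)" for v using UV finV finite_subset by blast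
    have U_neq: "\<phi> u \<noteq> \<phi> v \<and> \<theta> u \<noteq> \<theta> v" if "u \<in> U v" for u v
      using that nbhd_color_neq[OF col(1)] nbhd_color_neq[OF col(2)] by (auto simp: U_def)
    define N where "N = {v\<in>V. b * real (card (V - U v)) < 1}"
    have heavy: "b * real (card (U v)) \<le> real k + 1" if v: "v \<in> V - N" for v
    proof -
      have "card (V - U v) = card V - card (U v)" using UV finU by (simp add: card_Diff_subset)
      moreover have "card (U v) \<le> card V" using UV finV by (simp add: card_mono)
      ultimately have "b * real (card (V - U v)) = b * real (card V) - b * real (card (U v))"
        by (simp add: of_nat_diff algebra_simps)
      then show ?thesis using v tot by (auto simp: N_def)
    qed
    have link_matched: "matched \<phi> \<theta> (U v)" if v: "v \<in> V - N" for v
      unfolding U_def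
    proof (rule IH[OF codegree_graph_link proper_coloring_link[OF G col(1)]
          proper_coloring_link[OF G col(2)]])
      show "codegree_graph (Suc r') d V E" using G by (simp add: r_def)
      show "1 \<le> r'" using r3 by (simp add: r_def)
      have "\<phi> v \<in> R" "\<theta> v \<in> C" using v col by (auto simp: proper_coloring_def)
      then show "card (R - {\<phi> v}) = m + r'" "card (C - {\<theta> v}) = m + r'"
        using fin cards by (simp_all add: k_def r_def)
      show "b * real (card (nbhd E v)) \<le> real m + real r' + 2"
        using heavy[OF v] by (simp add: U_def k_def r_def)
    qed (use fin b0 deg in auto)
    \<comment> \<open>If colour \<open>i\<close> were missing, any \<open>m\<close> of the other
      \<open>k - 3\<close> classes would weigh more than \<open>m + 1\<close>. Averaging against the
      total \<open>k + 1\<close> of \<open>U v\<close> gives \<open>k < 4 * m + 3\<close>, contrary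
      to \<open>3 * m + 3 \<le> r\<close>.\<close>
    have common: "\<exists>y\<in>U v \<inter> U x. \<phi> y = i"
      if v: "v \<in> V - N" and x: "x \<in> U v" and i: "i \<in> R" "i \<noteq> \<phi> v" "i \<noteq> \<phi> x" for v x i
    proof (rule ccontr)
      assume none: "\<not> ?thesis"
      let ?g = "\<lambda>i. b * real (card {y\<in>U v \<inter> U x. \<phi> y = i})" and ?Q = "R - {\<phi> v, \<phi> x, i}"
      have vx: "\<phi> v \<in> R" "\<phi> x \<in> R" "\<phi> x \<noteq> \<phi> v"
        using v subsetD[OF UV x] col(1) U_neq[OF x] by (auto simp: proper_coloring_def)
      have large: "real m + 1 < sum ?g I" if I: "I \<subseteq> R - {\<phi> v, \<phi> x}" "card I = m + 1" for I
      proof -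
        have "real d \<le> real (card {y\<in>U v \<inter> U x. \<phi> y \<in> I})"
          using codegree_le_common_nbhd_classes[OF G col(1) fin(1), of v x I] v x I cards r3
          by (auto simp: U_def k_def)
        then have "b * real d \<le> b * real (card {y\<in>U v \<inter> U x. \<phi> y \<in> I})" using b0 by simp
        moreover have "finite I" using I(1) fin finite_subset by blast
        ultimately show ?thesis using deg card_classes_sum[of "U v \<inter> U x" I b \<phi>] finU by simp
      qed
      have "{y\<in>U v \<inter> U x. \<phi> y = i} = {}" using none by auto
      then have gi: "?g i = 0" by (simp only: card.empty)
      have large': "real m + 1 < sum ?g I" if I: "I \<subseteq> ?Q" "card I = m" for I
      proof -
        have finI: "finite I" using I(1) fin finite_subset by blast
        have "real m + 1 < sum ?g (insert i I)"
          using I finI i by (intro large) (auto simp: card_insert_if)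
        also have "\<dots> = ?g i + sum ?g I" using I(1) finI by (subst sum.insert) auto
        finally show ?thesis using gi by linarith
      qed
      have cQ: "card ?Q = k - 3" using vx i fin cards by (simp add: card_Diff_subset)
      have "m \<noteq> 0" using large'[of "{}"] by auto
      then have k: "m < k - 3" using r3 by (auto simp: k_def)
      have "(real m + 1) * real (card ?Q - card ({} :: 'b set)) <
          sum ?g {} * real (card ?Q - card ({} :: 'b set)) + real m * sum ?g (?Q - {})"
        by (rule subset_sum_average) (use fin cQ k large' in auto)
      then have "(real m + 1) * (real k - 3) < real m * sum ?g ?Q"
        using cQ k by (simp add: of_nat_diff)
      also have "sum ?g ?Q = b * real (card {y\<in>U v \<inter> U x. \<phi> y \<in> ?Q})"
        using card_classes_sum[of "U v \<inter> U x" ?Q b \<phi>] finU fin by simp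
      also have "real m * \<dots> \<le> real m * (b * real (card (U v)))"
        using b0 finU by (intro mult_left_mono) (auto intro!: card_mono)
      also have "\<dots> \<le> real m * (real k + 1)" using heavy[OF v] by (intro mult_left_mono) auto
      finally have "real k < 4 * real m + 3" by (simp add: algebra_simps)
      then show False using r3 by (simp add: k_def)
    qed
    let ?fr = "frame \<phi> \<theta> U"
    have fr_eq: "?fr u = ?fr v" if e: "e \<in> E" and u: "u \<in> e - N" and v: "v \<in> e - N" for e u v
    proof (cases "u = v")
      case False
      have VN: "u \<in> V - N" "v \<in> V - N" using edge[OF e] u v by auto
      have adj: "u \<in> U v" "v \<in> U u" using e u v False by (auto simp: U_def nbhd_def)
      have sub: "?fr v \<subseteq> ?fr u" if v: "v \<in> V - N" and adj: "u \<in> U v" "v \<in> U u" for u v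
      proof (rule frame_subset[of \<phi> \<theta> U, OF link_matched[OF v] adj])
        show "\<exists>y\<in>U v \<inter> U u. \<phi> y = \<phi> x" if "x \<in> U v" "\<phi> x \<noteq> \<phi> u" for x
          using common[OF v adj(1) _ _ that(2)] U_neq[OF that(1)] subsetD[OF UV that(1)] col(1)
          by (auto simp: proper_coloring_def)
      qed
      show ?thesis using sub[OF VN(2) adj] sub[OF VN(1) adj(2,1)] by blast
    qed simp
    \<comment> \<open>Light vertices lie in rows of weight below \<open>1\<close>, of which the
      class bound allows at most \<open>m\<close>. So more than \<open>m\<close> vertices of one
      edge include a heavy one; this covers shadow sets, as \<open>m < r - 1\<close>.\<close>
    define Bad where "Bad = {i\<in>R. b * real (card {x\<in>V. \<phi> x = i}) < 1}"
    have rows: "real m + 1 < (\<Sum>i\<in>I. b * real (card {x\<in>V'. \<phi> x = i}))"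
      if "codegree_graph r d V' E'" "E' \<noteq> {}" "V' \<subseteq> V" "E' \<subseteq> E" "I \<subseteq> R" "card I = m + 1" for V' E' I
    proof -
      have "proper_coloring R V' E' \<phi>" using that(3,4) col(1) by (auto simp: proper_coloring_def)
      then have "real d \<le> real (card {x\<in>V'. \<phi> x \<in> I})"
        using codegree_le_classes[OF that(1) _ fin(1) _ that(2,5)] that(6) cards r3
        by (auto simp: k_def)
      then have "b * real d \<le> b * real (card {x\<in>V'. \<phi> x \<in> I})" using b0 by simp
      moreover have "finite I" "finite V'"
        using finite_subset[OF that(5) fin(1)] finite_subset[OF that(3) finV] .
      ultimately show ?thesis using deg card_classes_sum[of V' I b \<phi>] by simp
    qed
    have "E \<noteq> {}" using \<open>V \<noteq> {}\<close> covered by auto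
    have finBad: "finite Bad" using fin by (simp add: Bad_def)
    have cBad: "card Bad \<le> m"
    proof (rule ccontr)
      assume "\<not> ?thesis"
      then have "m + 1 \<le> card Bad" by simp
      then obtain I where I: "I \<subseteq> Bad" "card I = m + 1"
        using obtain_subset_with_card_n by metis
      have "real m + 1 < (\<Sum>i\<in>I. b * real (card {x\<in>V. \<phi> x = i}))"
        using rows[OF G \<open>E \<noteq> {}\<close>] I by (auto simp: Bad_def)
      also have "\<dots> \<le> (\<Sum>i\<in>I. 1)" using I by (intro sum_mono) (auto simp: Bad_def)
      finally show False using I by simp
    qed
    have N_Bad: "\<phi> v \<in> Bad" if "v \<in> N" for v
    proof -
      have v: "v \<in> V" using that by (simp add: N_def)
      have "{x\<in>V. \<phi> x = \<phi> v} \<subseteq> V - U v" using U_neq by auto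
      then have "real (card {x\<in>V. \<phi> x = \<phi> v}) \<le> real (card (V - U v))"
        using finV by (simp add: card_mono)
      then have "b * real (card {x\<in>V. \<phi> x = \<phi> v}) \<le> b * real (card (V - U v))" using b0 by simp
      then show ?thesis using that v col(1) by (auto simp: N_def Bad_def proper_coloring_def)
    qed
    have heavy_in: "\<exists>u. u \<in> S - N" if e: "e \<in> E" "S \<subseteq> e" and S: "m < card S" for e S
    proof (rule ccontr)
      assume "\<not> ?thesis"
      then have "\<phi> ` S \<subseteq> Bad" using N_Bad by auto
      then have "card (\<phi> ` S) \<le> m" using card_mono[OF finBad, of "\<phi> ` S"] cBad by linarith
      moreover have "inj_on \<phi> S" using e col(1) by (auto simp: proper_coloring_def intro: inj_on_subset)
      ultimately show False using S card_image[of \<phi> S] by simp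
    qed
    \<comment> \<open>Edges are sorted by the common frame of their heavy vertices. A shadow set
      already contains a heavy vertex, so all its extensions fall into the same part and codegrees
      are inherited.\<close>
    define EE where "EE \<sigma> = {e\<in>E. \<exists>u\<in>e - N. ?fr u = \<sigma>}" for \<sigma>
    define VV where "VV \<sigma> = \<Union> (EE \<sigma>)" for \<sigma>
    have VV_sub: "VV \<sigma> \<subseteq> V" for \<sigma> using edge by (auto simp: VV_def EE_def)
    have G_class: "codegree_graph r d (VV \<sigma>) (EE \<sigma>)" for \<sigma>
      unfolding codegree_graph_def
    proof (intro conjI ballI allI impI)
      show "finite (VV \<sigma>)" using VV_sub finV finite_subset by blast
      fix S assume S: "card S = r - 1" "\<exists>e\<in>EE \<sigma>. S \<subseteq> e"
      then obtain e u where e: "e \<in> E" "S \<subseteq> e" and u: "u \<in> e - N" "?fr u = \<sigma>" by (auto simp: EE_def)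
      have "m < card S" using S(1) r3 by simp
      then obtain u' where u': "u' \<in> S - N" using heavy_in[OF e] by auto
      then have fu': "?fr u' = \<sigma>" using fr_eq[OF e(1) u(1), of u'] u(2) e(2) by auto
      have "d \<le> card {v\<in>V. insert v S \<in> E}" using G S(1) e by (auto simp: codegree_graph_def)
      also have "\<dots> \<le> card {v\<in>VV \<sigma>. insert v S \<in> EE \<sigma>}"
      proof (rule card_mono)
        show "finite {v\<in>VV \<sigma>. insert v S \<in> EE \<sigma>}"
          using \<open>finite (VV \<sigma>)\<close> by simp
        show "{v\<in>V. insert v S \<in> E} \<subseteq> {v\<in>VV \<sigma>. insert v S \<in> EE \<sigma>}"
          using u' fu' by (auto simp: VV_def EE_def)
      qed
      finally show "d \<le> card {v\<in>VV \<sigma>. insert v S \<in> EE \<sigma>}" .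
    qed (use edge in \<open>auto simp: VV_def EE_def\<close>)
    \<comment> \<open>Averaging with \<open>T = {}\<close> over \<open>Q\<close>: any
      \<open>m + 1\<close> rows weigh more than \<open>m + 1\<close>, so the mean row weight exceeds
      \<open>1\<close>.\<close>
    have weight: "real (card Q) < b * real (card {x\<in>VV \<sigma>. \<phi> x \<in> Q})"
      if "EE \<sigma> \<noteq> {}" and Q: "Q \<subseteq> R" "m + 1 \<le> card Q" for \<sigma> Q
    proof -
      let ?f = "\<lambda>i. b * real (card {x\<in>VV \<sigma>. \<phi> x = i})"
      have finQ: "finite Q" using Q fin finite_subset by auto
      have "(real m + 1) * real (card Q - card ({} :: 'b set)) <
          sum ?f {} * real (card Q - card ({} :: 'b set)) + real (m + 1) * sum ?f (Q - {})"
      proof (rule subset_sum_average)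
        show "real m + 1 < sum ?f I" if "I \<subseteq> Q" "card I = card ({} :: 'b set) + (m + 1)" for I
          using rows[OF G_class \<open>EE \<sigma> \<noteq> {}\<close> VV_sub, of I] that Q by (auto simp: EE_def)
      qed (use Q finQ in auto)
      then have "(real m + 1) * real (card Q) < (real m + 1) * sum ?f Q" by (simp add: add.commute)
      then have "real (card Q) < sum ?f Q" by (rule mult_left_less_imp_less) simp
      then show ?thesis
        using card_classes_sum[of "VV \<sigma>" Q b \<phi>] finQ VV_sub finV finite_subset[of "VV \<sigma>" V] by simp
    qed
    have in_class: "\<exists>u\<in>V - N. x \<in> VV (?fr u) \<and> (\<phi> x, \<theta> x) \<in> ?fr u \<and> EE (?fr u) \<noteq> {}" if x: "x \<in> V" for x
    proof -
      obtain e where e: "e \<in> E" "x \<in> e" using covered x by auto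
      obtain u where u: "u \<in> e - N" using heavy_in[OF e(1) subset_refl] edge[OF e(1)] r3 by auto
      have "x = u \<or> x \<in> U u" using e u by (auto simp: U_def nbhd_def)
      then have "(\<phi> x, \<theta> x) \<in> ?fr u" by (auto simp: frame_def)
      moreover have "e \<in> EE (?fr u)" using e u by (auto simp: EE_def)
      ultimately show ?thesis using e u edge[OF e(1)] by (intro bexI[of _ u]) (auto simp: VV_def)
    qed
    obtain x y where xy: "x \<in> V" "y \<in> V" "(\<phi> x = \<phi> y) \<noteq> (\<theta> x = \<theta> y)"
      using nm by (auto simp: matched_def)
    obtain u v where u: "u \<in> V - N" "(\<phi> x, \<theta> x) \<in> ?fr u" "EE (?fr u) \<noteq> {}"
      and v: "v \<in> V - N" "(\<phi> y, \<theta> y) \<in> ?fr v" "EE (?fr v) \<noteq> {}"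
      using in_class[OF xy(1)] in_class[OF xy(2)] by blast
    have ne: "?fr u \<noteq> ?fr v"
    proof
      assume "?fr u = ?fr v"
      then have "(\<phi> x, \<theta> x) \<in> ?fr v" using u(2) by simp
      from frame_functional[OF link_matched[OF v(1)] U_neq this v(2)] show False using xy(3) by simp
    qed
    have inter: "z \<in> N" if z: "z \<in> VV (?fr u)" "z \<in> VV (?fr v)" for z
    proof (rule ccontr)
      assume "z \<notin> N"
      have "?fr z = \<sigma>" if \<sigma>: "z \<in> VV \<sigma>" for \<sigma>
      proof -
        obtain e t where "e \<in> E" "z \<in> e" "t \<in> e - N" "?fr t = \<sigma>"
          using \<sigma> by (auto simp: VV_def EE_def)
        then show ?thesis using fr_eq[of e z t] \<open>z \<notin> N\<close> by simp
      qed
      from this[OF z(1)] this[OF z(2)] show False using ne by simp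
    qed
    \<comment> \<open>Two parts meet only in light vertices, hence only in bad rows. Counting one
      part on all rows and the other on good rows gives disjoint sets of total weight above
      \<open>k + r\<close>, more than \<open>k + 2\<close>.\<close>
    let ?Good = "R - Bad"
    let ?A = "{x\<in>VV (?fr u). \<phi> x \<in> R}" and ?B = "{x\<in>VV (?fr v). \<phi> x \<in> ?Good}"
    have "card ?Good + m \<ge> k" using cBad cards fin finBad by (simp add: card_Diff_subset Bad_def)
    then have cG: "r \<le> card ?Good" by (simp add: k_def)
    have "real k < b * real (card ?A)" using weight[OF u(3), of R] cards r3 by (simp add: k_def)
    moreover have "real (card ?Good) < b * real (card ?B)" using weight[OF v(3), of ?Good] cG r3 by auto
    moreover have "card ?A + card ?B \<le> card V"
    proof -
      have "?A \<inter> ?B = {}" using inter N_Bad by auto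
      then have "card ?A + card ?B = card (?A \<union> ?B)"
        using finite_subset[OF VV_sub finV] by (simp add: card_Un_disjoint)
      also have "\<dots> \<le> card V" using VV_sub finV by (intro card_mono) auto
      finally show ?thesis .
    qed
    then have "b * (real (card ?A) + real (card ?B)) \<le> b * real (card V)"
      using b0 by (intro mult_left_mono) linarith+
    ultimately show False using tot cG r3 by (simp add: distrib_left)
  qed
qed


lemma matched_imp_equivalent:
  assumes "\<phi> \<in> V \<rightarrow> {1..k}" "\<theta> \<in> V \<rightarrow> {1..k}" "matched \<phi> \<theta> V"
  shows "equivalent_colorings k V \<phi> \<theta>"
proof -
  define f where "f i = \<theta> (SOME v. v \<in> V \<and> \<phi> v = i)" for i
  have f: "f (\<phi> v) = \<theta> v" if "v \<in> V" for v
  proof -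
    have "(SOME u. u \<in> V \<and> \<phi> u = \<phi> v) \<in> V \<and> \<phi> (SOME u. u \<in> V \<and> \<phi> u = \<phi> v) = \<phi> v"
      using that by (intro someI[of "\<lambda>u. u \<in> V \<and> \<phi> u = \<phi> v" v]) simp
    then show ?thesis using assms(3) that by (auto simp: f_def matched_def)
  qed
  have bf: "bij_betw f (\<phi> ` V) (\<theta> ` V)"
    unfolding bij_betw_def
  proof
    show "inj_on f (\<phi> ` V)" using f assms(3) by (auto simp: inj_on_def matched_def)
    show "f ` \<phi> ` V = \<theta> ` V" using f by (force simp: image_image)
  qed
  have sub: "\<phi> ` V \<subseteq> {1..k}" "\<theta> ` V \<subseteq> {1..k}" using assms by auto
  have "card ({1..k} - \<phi> ` V) = card ({1..k} - \<theta> ` V)"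
    using sub bij_betw_same_card[OF bf] by (simp add: card_Diff_subset finite_subset[OF _ finite_atLeastAtMost])
  then obtain g where bg: "bij_betw g ({1..k} - \<phi> ` V) ({1..k} - \<theta> ` V)"
    using finite_same_card_bij[of "{1..k} - \<phi> ` V" "{1..k} - \<theta> ` V"] by auto
  define \<eta> where "\<eta> i = (if i \<in> \<phi> ` V then f i else if i \<in> {1..k} then g i else i)" for i
  have "bij_betw \<eta> (\<phi> ` V) (\<theta> ` V)"
    using bf by (rule bij_betw_cong[THEN iffD1, rotated]) (simp add: \<eta>_def)
  moreover have "bij_betw \<eta> ({1..k} - \<phi> ` V) ({1..k} - \<theta> ` V)"
    using bg by (rule bij_betw_cong[THEN iffD1, rotated]) (simp add: \<eta>_def)
  ultimately have "bij_betw \<eta> (\<phi> ` V \<union> ({1..k} - \<phi> ` V)) (\<theta> ` V \<union> ({1..k} - \<theta> ` V))"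
    by (rule bij_betw_combine) auto
  then have "bij_betw \<eta> {1..k} {1..k}" using sub by (simp add: Un_absorb1)
  moreover have "\<eta> i = i" if "i \<notin> {1..k}" for i using that sub by (auto simp: \<eta>_def)
  ultimately have "\<eta> permutes {1..k}" by (rule bij_imp_permutes)
  moreover have "\<theta> v = \<eta> (\<phi> v)" if "v \<in> V" for v using that f by (simp add: \<eta>_def)
  ultimately show ?thesis by (auto simp: equivalent_colorings_def)
qed

section \<open>Optimality\<close>

text \<open>The extremal example: a blow-up, with classes of size \<open>a\<close>, of the join of a complete graph on
  \<open>k - 2\<close> vertices with the two disjoint edges \<open>{0, 1}\<close> and \<open>{2, 3}\<close>; the colourings \<open>\<phi>\<close> and \<open>\<theta>\<close> differ
  by a switch on \<open>{2, 3}\<close>, and the edges are the \<open>r\<close>-sets on which both are injective.\<close>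

locale extremal =
  fixes k a :: nat
  assumes k: "2 \<le> k" and a: "1 \<le> a" "a \<le> 3"
begin

text \<open>Only the \<open>k - 2\<close> vertices of the complete graph are blown up, while
  \<open>0\<close> to \<open>3\<close> stay single. This makes \<open>k + 2\<close> vertices for
  \<open>a = 1\<close> and \<open>3 * k - 2\<close> for \<open>a = 3\<close>.\<close>

definition vs :: "nat set" where "vs = {0..<4 + a * (k - 2)}"

definition \<phi> :: "nat \<Rightarrow> nat" where "\<phi> v = (if v < 4 then v mod 2 + 1 else (v - 4) div a + 3)"

definition \<theta> :: "nat \<Rightarrow> nat" where "\<theta> v = (if v = 2 then 2 else if v = 3 then 1 else \<phi> v)"

definition good :: "nat set \<Rightarrow> bool" where "good S \<longleftrightarrow> S \<subseteq> vs \<and> inj_on \<phi> S \<and> inj_on \<theta> S"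

definition free :: "nat set \<Rightarrow> nat set" where "free S = {v\<in>vs. \<phi> v \<notin> \<phi> ` S \<and> \<theta> v \<notin> \<theta> ` S}"

definition edges :: "nat \<Rightarrow> nat set set" where "edges r = {e. good e \<and> card e = r}"

lemma small_cases: "v < 4 \<Longrightarrow> v = 0 \<or> v = 1 \<or> v = 2 \<or> v = (3 :: nat)"
  by auto

lemma \<phi>_small: "v < 4 \<Longrightarrow> \<phi> v \<in> {1, 2}" and \<theta>_small: "v < 4 \<Longrightarrow> \<theta> v \<in> {1, 2}"
  by (auto simp: \<phi>_def \<theta>_def)

lemma \<theta>_large: "4 \<le> v \<Longrightarrow> \<theta> v = \<phi> v"
  by (simp add: \<theta>_def)

lemma \<phi>_large: "v \<in> vs \<Longrightarrow> 4 \<le> v \<Longrightarrow> \<phi> v \<in> {3..k}"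
proof -
  assume v: "v \<in> vs" "4 \<le> v"
  then have "v - 4 < (k - 2) * a" by (auto simp: vs_def mult.commute)
  then have "(v - 4) div a < k - 2" by (rule less_mult_imp_div_less)
  then show ?thesis using v by (auto simp: \<phi>_def)
qed

lemma finite_vs: "finite vs"
  by (simp add: vs_def)

lemma card_large_class:
  assumes "j \<in> {3..k}"
  shows "card {v\<in>vs. 4 \<le> v \<and> \<phi> v = j} = a"
proof -
  have "{v\<in>vs. 4 \<le> v \<and> \<phi> v = j} = {4 + a * (j - 3)..<4 + a * (j - 3) + a}"
  proof (intro set_eqI iffI)
    fix v assume "v \<in> {v\<in>vs. 4 \<le> v \<and> \<phi> v = j}"
    then have v: "4 \<le> v" "(v - 4) div a = j - 3" by (auto simp: \<phi>_def)
    have "a * ((v - 4) div a) \<le> v - 4" "v - 4 < a * ((v - 4) div a) + a"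
      using a dividend_less_times_div[of a "v - 4"] by (auto simp: add.commute)
    then show "v \<in> {4 + a * (j - 3)..<4 + a * (j - 3) + a}" using v by auto
  next
    fix v assume v: "v \<in> {4 + a * (j - 3)..<4 + a * (j - 3) + a}"
    then obtain t where t: "v = 4 + a * (j - 3) + t" "t < a"
      by (metis add_less_cancel_left atLeastLessThan_iff le_Suc_ex)
    have "(v - 4) div a = j - 3" using t by simp
    moreover have "a * (j - 3) + a \<le> a * (k - 2)"
    proof -
      have "a * (j - 3) + a = a * (j - 3 + 1)" by simp
      also have "\<dots> \<le> a * (k - 2)" using assms by (intro mult_le_mono2) auto
      finally show ?thesis .
    qed
    ultimately show "v \<in> {v\<in>vs. 4 \<le> v \<and> \<phi> v = j}" using t assms by (auto simp: vs_def \<phi>_def)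
  qed
  then show ?thesis by simp
qed

lemma card_free:
  assumes S: "good S" and s: "card S < k"
  shows "a * (k - 1 - card S) + 1 \<le> card (free S)"
proof -
  have finS: "finite S" and SV: "S \<subseteq> vs" and inj: "inj_on \<phi> S" "inj_on \<theta> S"
    using S finite_subset[OF _ finite_vs] by (auto simp: good_def)
  define T where "T = {v\<in>S. v < 4}"
  define S' where "S' = {v\<in>S. 4 \<le> v}"
  have ST: "S = T \<union> S'" "T \<inter> S' = {}" by (auto simp: T_def S'_def)
  then have cS: "card S = card T + card S'" using finS by (metis card_Un_disjoint finite_Un)
  have colS': "\<phi> ` S' \<subseteq> {3..k}" using \<phi>_large SV by (auto simp: S'_def)
  have cS': "card (\<phi> ` S') = card S'"
    using inj(1) by (intro card_image) (auto simp: S'_def intro: inj_on_subset)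
  define J where "J = {3..k} - \<phi> ` S'"
  have cJ: "card J = k - 2 - card S'" and le: "card S' \<le> k - 2"
    using colS' cS' card_mono[OF finite_atLeastAtMost colS'] finite_subset[OF colS']
    by (auto simp: J_def card_Diff_subset)
  define F where "F = {v\<in>vs. 4 \<le> v \<and> \<phi> v \<in> J}"
  have "F = (\<Union>j\<in>J. {v\<in>vs. 4 \<le> v \<and> \<phi> v = j})" by (auto simp: F_def)
  then have "card F = (\<Sum>j\<in>J. card {v\<in>vs. 4 \<le> v \<and> \<phi> v = j})"
    using finite_vs by (simp only:) (rule card_UN_disjoint, auto simp: J_def)
  also have "\<dots> = card J * a" using card_large_class by (simp add: J_def)
  finally have cF: "card F = a * (k - 2 - card S')" using cJ by (simp add: mult.commute)
  have T_col: "\<phi> ` T \<subseteq> {1, 2}" "\<theta> ` T \<subseteq> {1, 2}" using \<phi>_small \<theta>_small by (auto simp: T_def)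
  have colS'\<theta>: "\<theta> ` S' = \<phi> ` S'" using \<theta>_large by (auto simp: S'_def)
  have Ffree: "F \<subseteq> free S"
  proof
    fix v assume v: "v \<in> F"
    then have "\<phi> v \<in> {3..k}" "\<phi> v \<notin> \<phi> ` S'" "\<theta> v = \<phi> v" using \<theta>_large by (auto simp: F_def J_def)
    then show "v \<in> free S" using v T_col colS'\<theta> unfolding ST(1) free_def image_Un
      by (auto simp: F_def)
  qed
  have finfree: "finite (free S)" using finite_vs by (simp add: free_def)
  have small_free: "v \<in> free S - F" if "v < 4" "\<phi> v \<notin> \<phi> ` T" "\<theta> v \<notin> \<theta> ` T" for v
  proof -
    have "v \<in> vs" using that by (simp add: vs_def)
    moreover have "\<phi> v \<notin> \<phi> ` S'" "\<theta> v \<notin> \<phi> ` S'"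
      using \<phi>_small[OF that(1)] \<theta>_small[OF that(1)] colS' by auto
    ultimately show ?thesis using that colS'\<theta> unfolding ST(1) free_def image_Un by (auto simp: F_def)
  qed
  have extra: "card F + card A \<le> card (free S)" if "A \<subseteq> free S - F" for A
  proof -
    have "card (F \<union> A) = card F + card A"
    proof (rule card_Un_disjoint)
      show "finite F" by (rule finite_subset[OF Ffree finfree])
      show "finite A" by (rule finite_subset[OF _ finfree]) (use that in blast)
    qed (use that in blast)
    moreover have "card (F \<union> A) \<le> card (free S)" using that Ffree finfree by (intro card_mono) auto
    ultimately show ?thesis by simp
  qed
  have finT: "finite T" using finS by (simp add: T_def)
  have "inj_on \<phi> T" using inj(1) by (auto simp: T_def intro: inj_on_subset)
  then have "card T = card (\<phi> ` T)" by (simp add: card_image)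
  also have "\<dots> \<le> card {1 :: nat, 2}" using T_col by (intro card_mono) auto
  finally have "card T \<le> 2" by simp
  then consider "card T = 0" | "card T = 1" | "card T = 2" by linarith
  then show ?thesis
  proof cases
    case 1
    then have "T = {}" using finT by simp
    then have "{0, 1, 2, 3} \<subseteq> free S - F" using small_free by auto
    then have "card F + 4 \<le> card (free S)" using extra[of "{0, 1, 2, 3}"] by simp
    moreover obtain p where p: "k - 2 = card S' + p" using le le_Suc_ex by blast
    then have "k - 1 - card S = p + 1" using cS 1 k by simp
    ultimately show ?thesis using cF p a by simp
  next
    case 2
    then obtain t where t: "T = {t}" by (auto simp: card_1_singleton_iff)
    then have "t < 4" by (auto simp: T_def)
    \<comment> \<open>\<open>p\<close> is the other end of the edge \<open>{0, 1}\<close> or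
      \<open>{2, 3}\<close> containing \<open>t\<close>, the one small vertex differing from
      \<open>t\<close> in both colourings.\<close>
    define p where "p = (if t = 0 then 1 else if t = 1 then 0 else if t = 2 then 3 else (2 :: nat))"
    have "p < 4" "\<phi> p \<noteq> \<phi> t" "\<theta> p \<noteq> \<theta> t"
      using small_cases[OF \<open>t < 4\<close>] by (auto simp: p_def \<phi>_def \<theta>_def)
    then have "{p} \<subseteq> free S - F" using small_free t by auto
    then have "card F + 1 \<le> card (free S)" using extra[of "{p}"] by simp
    moreover have "k - 1 - card S = k - 2 - card S'" using cS 2 by simp
    ultimately show ?thesis using cF by simp
  next
    case 3
    have "card F \<le> card (free S)" using extra[of "{}"] by simp
    moreover have "k - 2 - card S' = k - 1 - card S + 1" using cS 3 s by simp
    ultimately show ?thesis using cF a by simp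
  qed
qed

lemma good_insert: "good S \<Longrightarrow> v \<in> free S \<Longrightarrow> good (insert v S) \<and> v \<notin> S"
  by (auto simp: good_def free_def inj_on_insert)

lemma good_extend:
  assumes "v \<in> vs" "1 \<le> r" "r \<le> k"
  shows "\<exists>e\<in>edges r. v \<in> e"
  using assms(2,3)
proof (induction r rule: dec_induct)
  case base
  then show ?case using assms(1) by (intro bexI[of _ "{v}"]) (auto simp: edges_def good_def)
next
  case (step r)
  then obtain e where e: "good e" "card e = r" "v \<in> e" by (auto simp: edges_def)
  then have "card (free e) \<noteq> 0" using card_free[of e] step by simp
  then have "free e \<noteq> {}" by auto
  then obtain u where u: "u \<in> free e" by blast
  have "finite e" using e finite_subset[OF _ finite_vs] by (auto simp: good_def)
  then show ?case using good_insert[OF e(1) u] e by (intro bexI[of _ "insert u e"]) (auto simp: edges_def)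
qed

lemma colorings: "k_coloring k vs (edges r) \<phi>" "k_coloring k vs (edges r) \<theta>"
proof -
  have "\<phi> v \<in> {1..k} \<and> \<theta> v \<in> {1..k}" if v: "v \<in> vs" for v
  proof (cases "v < 4")
    case True
    then show ?thesis using \<phi>_small[OF True] \<theta>_small[OF True] k by auto
  next
    case False
    then show ?thesis using \<phi>_large[OF v] \<theta>_large[of v] by auto
  qed
  then show "k_coloring k vs (edges r) \<phi>" "k_coloring k vs (edges r) \<theta>"
    by (auto simp: k_coloring_def edges_def good_def)
qed

text \<open>\<open>0\<close> and \<open>2\<close> agree under \<open>\<phi>\<close> but not under
  \<open>\<theta>\<close>.\<close>

lemma not_unique: "\<not> uniquely_k_colorable k vs (edges r)"
proof
  assume "uniquely_k_colorable k vs (edges r)"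
  then have "equivalent_colorings k vs \<phi> \<theta>" using colorings by (auto simp: uniquely_k_colorable_def)
  then obtain \<eta> where \<eta>: "\<And>v. v \<in> vs \<Longrightarrow> \<theta> v = \<eta> (\<phi> v)" by (auto simp: equivalent_colorings_def)
  have "\<theta> 0 = \<eta> 1" "\<theta> 2 = \<eta> 1" using \<eta>[of 0] \<eta>[of 2] by (simp_all add: vs_def \<phi>_def)
  moreover have "\<theta> 0 = 1" "\<theta> 2 = 2" by (simp_all add: \<theta>_def \<phi>_def)
  ultimately show False by simp
qed

lemma min_codegree:
  assumes r: "2 \<le> r" "r \<le> k"
  shows "a * (k - r) + 1 \<le> min_pos_codegree r vs (edges r)"
proof -
  have fin: "finite (shadow r vs (edges r))"
    by (rule finite_subset[of _ "Pow vs"]) (use finite_vs in \<open>auto simp: shadow_def\<close>)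
  \<comment> \<open>An edge is exhibited to make the shadow nonempty, because \<open>Min\<close> of
    the empty set is unspecified.\<close>
  have "0 \<in> vs" by (simp add: vs_def)
  then obtain e where e: "e \<in> edges r" using good_extend[of 0 r] r by auto
  then have "card e = r" "e \<subseteq> vs" by (auto simp: edges_def good_def)
  then obtain S where S: "S \<subseteq> e" "card S = r - 1"
    using obtain_subset_with_card_n[of "r - 1" e] by (metis diff_le_self)
  then have "S \<in> shadow r vs (edges r)" using e \<open>e \<subseteq> vs\<close> by (auto simp: shadow_def)
  then have ne: "codegree vs (edges r) ` shadow r vs (edges r) \<noteq> {}" by auto
  have "a * (k - r) + 1 \<le> codegree vs (edges r) S" if "S \<in> shadow r vs (edges r)" for S
  proof -
    from that obtain e where c: "card S = r - 1" and e: "good e" "S \<subseteq> e"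
      by (auto simp: shadow_def edges_def)
    then have g: "good S" unfolding good_def by (meson inj_on_subset subset_trans)
    have finS: "finite S" using g finite_subset[OF _ finite_vs] by (auto simp: good_def)
    have "a * (k - r) + 1 \<le> card (free S)" using card_free[OF g] c r by simp
    also have "\<dots> \<le> codegree vs (edges r) S"
      unfolding codegree_def
    proof (rule card_mono)
      show "free S \<subseteq> {v\<in>vs. S \<union> {v} \<in> edges r}"
      proof
        fix v assume v: "v \<in> free S"
        have "good (insert v S)" "card (insert v S) = r" using good_insert[OF g v] c finS r by auto
        then show "v \<in> {v\<in>vs. S \<union> {v} \<in> edges r}" using v by (simp add: edges_def free_def)
      qed
    qed (use finite_vs in simp)
    finally show ?thesis .
  qed
  then show ?thesis using ne fin by (simp add: min_pos_codegree_def)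
qed

lemma extremal_example:
  assumes r: "2 \<le> r" "r \<le> k" and c: "c * real (4 + a * (k - 2)) < real (a * (k - r) + 1)"
  shows "\<exists>n\<ge>k. \<exists>(V :: nat set) E. r_graph r V E \<and> card V = n \<and> k_partite k V E \<and>
    no_isolated_vertices V E \<and> real (min_pos_codegree r V E) > c * real n \<and>
    \<not> uniquely_k_colorable k V E"
proof (intro exI conjI)
  show "r_graph r vs (edges r)" using finite_vs by (auto simp: r_graph_def edges_def good_def)
  show "card vs = 4 + a * (k - 2)" by (simp add: vs_def)
  have "1 * (k - 2) \<le> a * (k - 2)" using a by (intro mult_le_mono1) auto
  then show "k \<le> 4 + a * (k - 2)" by linarith
  show "k_partite k vs (edges r)" using colorings by (auto simp: k_partite_def)
  show "no_isolated_vertices vs (edges r)" using good_extend r by (auto simp: no_isolated_vertices_def)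
  have "real (a * (k - r) + 1) \<le> real (min_pos_codegree r vs (edges r))"
    using min_codegree[OF r] by (simp only: of_nat_le_iff)
  then show "c * real (4 + a * (k - 2)) < real (min_pos_codegree r vs (edges r))" using c by linarith
qed (rule not_unique)

end

section \<open>The theorem\<close>

text \<open>Without edges the minimum is unspecified, but then the codegree condition is
  vacuous.\<close>

lemma codegree_graph_of_r_graph:
  assumes G: "r_graph r V E" and iso: "no_isolated_vertices V E"
  shows "codegree_graph r (min_pos_codegree r V E) V E"
  unfolding codegree_graph_def
proof (intro conjI allI impI)
  show finV: "finite V" and sub: "\<forall>e\<in>E. e \<subseteq> V \<and> card e = r" using G by (auto simp: r_graph_def)
  show "\<forall>v\<in>V. \<exists>e\<in>E. v \<in> e" using iso by (simp add: no_isolated_vertices_def)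
  fix S assume S: "card S = r - 1" "\<exists>e\<in>E. S \<subseteq> e"
  have "S \<in> shadow r V E" using S sub by (auto simp: shadow_def)
  moreover have "finite (shadow r V E)"
    by (rule finite_subset[of _ "Pow V"]) (use finV in \<open>auto simp: shadow_def\<close>)
  ultimately have "min_pos_codegree r V E \<le> codegree V E S" by (simp add: min_pos_codegree_def)
  then show "min_pos_codegree r V E \<le> card {v\<in>V. insert v S \<in> E}" by (simp add: codegree_def)
qed

lemma unique_of_large_codegree:
  assumes r: "2 \<le> r" "r \<le> k" and n: "k \<le> card V"
    and G: "r_graph r V E" "k_partite k V E" "no_isolated_vertices V E"
    and deg: "c_const k r * real (card V) < real (min_pos_codegree r V E)"
  shows "uniquely_k_colorable k V E"
  unfolding uniquely_k_colorable_def
proof (intro conjI allI impI)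
  show "k_partite k V E" by fact
  fix \<phi> \<theta> assume col: "k_coloring k V E \<phi>" "k_coloring k V E \<theta>"
  define m where "m = k - r"
  have k: "k = m + r" using r by (simp add: m_def)
  let ?n = "real (card V)" and ?d = "min_pos_codegree r V E"
  have n0: "0 < ?n" using n r by simp
  have H: "codegree_graph r ?d V E" by (rule codegree_graph_of_r_graph[OF G(1,3)])
  have proper: "proper_coloring {1..k} V E \<phi>" "proper_coloring {1..k} V E \<theta>"
    using col by (auto simp: k_coloring_def proper_coloring_def)
  have cards: "card {1..k} = m + r" using k by simp
  have "matched \<phi> \<theta> V"
  proof (cases "real k < (4 * real r - 2) / 3")
    case True
    \<comment> \<open>With \<open>k = m + r\<close> the case condition reads
      \<open>3 * m + 2 < r\<close>.\<close>
    then have "3 * m + 2 \<le> r" using k by auto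
    moreover have "c_const k r = (real m + 1) / (real k + 2)" using True k by (simp add: c_const_def)
    then have "(real m + 1) / (real k + 2) * ?n < real ?d" using deg by simp
    then have "real m + 1 < (real k + 2) / ?n * real ?d" using n0 by (simp add: field_simps)
    ultimately show ?thesis
      using coloring_rigid_sparse[OF _ H proper _ _ cards cards, of "(real k + 2) / ?n"] n0 k by simp
  next
    case False
    then have r3: "r \<le> 3 * m + 2" using k by auto
    have "c_const k r = (3 * real m + 1) / (3 * real k - 2)"
      using False k by (simp add: c_const_def)
    then have "(3 * real m + 1) / (3 * real k - 2) * ?n < real ?d" using deg by simp
    moreover have k2: "0 < 3 * real k - 2" using r by simp
    ultimately have "3 * real m + 1 < (3 * real k - 2) / ?n * real ?d"
      using n0 by (simp add: field_simps)
    then show ?thesis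
      using coloring_rigid_dense[OF r(1) r3 H proper _ _ cards cards,
          of "(3 * real k - 2) / ?n"] n0 k k2 by simp
  qed
  then show "equivalent_colorings k V \<phi> \<theta>"
    using matched_imp_equivalent col by (auto simp: k_coloring_def)
qed

text \<open>Blow-up size \<open>1\<close> gives codegree at least \<open>k - r + 1\<close> on
  \<open>k + 2\<close> vertices, and size \<open>3\<close> gives at least
  \<open>3 * (k - r) + 1\<close> on \<open>3 * k - 2\<close> vertices; these ratios are the two
  values of \<open>c_const\<close>.\<close>

lemma c_const_optimal:
  assumes r: "2 \<le> r" "r \<le> k" and c: "c < c_const k r"
  shows "\<exists>n\<ge>k. \<exists>(V :: nat set) E. r_graph r V E \<and> card V = n \<and> k_partite k V E \<and>
    no_isolated_vertices V E \<and> real (min_pos_codegree r V E) > c * real n \<and>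
    \<not> uniquely_k_colorable k V E"
proof (cases "real k < (4 * real r - 2) / 3")
  case True
  interpret extremal k 1 by unfold_locales (use r in auto)
  have "c < (real k - real r + 1) / (real k + 2)" using c True by (simp add: c_const_def)
  then have "c * (real k + 2) < real k - real r + 1" by (simp add: pos_less_divide_eq add_nonneg_pos)
  then show ?thesis using r by (intro extremal_example) (simp_all add: of_nat_diff algebra_simps)
next
  case False
  interpret extremal k 3 by unfold_locales (use r in auto)
  have "c < (3 * real k - 3 * real r + 1) / (3 * real k - 2)" using c False by (simp add: c_const_def)
  moreover have "0 < 3 * real k - 2" using r by simp
  ultimately have "c * (3 * real k - 2) < 3 * real k - 3 * real r + 1" by (simp add: pos_less_divide_eq)
  then show ?thesis using r by (intro extremal_example) (simp_all add: of_nat_diff algebra_simps)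
qed

theorem theorem1p2:
  fixes k r :: nat
  assumes "2 \<le> r" and "r \<le> k"
  shows "(\<forall>n\<ge>k. \<forall>(V :: 'a set) E.
            r_graph r V E \<and> card V = n \<and> k_partite k V E \<and> no_isolated_vertices V E \<and>
            real (min_pos_codegree r V E) > c_const k r * real n
            \<longrightarrow> uniquely_k_colorable k V E)
       \<and> (\<forall>c < c_const k r. \<exists>n\<ge>k. \<exists>(V :: nat set) E.
            r_graph r V E \<and> card V = n \<and> k_partite k V E \<and> no_isolated_vertices V E \<and>
            real (min_pos_codegree r V E) > c * real n \<and>
            \<not> uniquely_k_colorable k V E)"
  using unique_of_large_codegree[OF assms] c_const_optimal[OF assms] by blast

end
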